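(* Let $\mathbb{E}$ be a regular category and let $m\geq 1$ be an integer. The following conditions are equivalent: 1) $\mathbb{E}$ is congruence $(2m+1)$-permutable; 2) for any regular epimorphism $f:X\to Y$ in $\mathbb{E}$ and any equivalence relation $R$ on $X$, the direct image $f(R)$ is such that $f(R)^m$ is an equivalence relation. When $\mathbb{E}$ is congruence $2m$-permutable, the direct image $f(R)$ along a regular epimorphism $f$ of any equivalence relation $R$ is such that $f(R)^m$ is an equivalence relation. Accordingly, in any congruence $n$-permutable regular category $\mathbb{E}$ ($n\geq 2$), there are cocartesian images of equivalence relations: for any regular epimorphism $f:X\to Y$ and any equivalence relation $R$ on $X$, there is a cocartesian map with domain $R$ above $f$ in $Equ\,\mathbb{E}$ with respect to $(\;)_0$.
   Context: A relation on $X$ is (a class up to isomorphism of) a subobject $R\rightarrowtail X\times X$, ordered by inclusion. In a regular category relations compose: $SR=S\circ R$ is the usual composite relation ($x(SR)z$ iff there is $y$ with $xRy$ and $ySz$), defined by a pullback followed by the regular epi–mono factorization; $R^m$ is the $m$-fold composite. Equivalence relations are internal ones: $\Delta_X\subset R$, $R^{op}\subset R$, $R\circ R\subset R$. For a regular epimorphism $f:X\to Y$ and a relation $R$ on $X$, the direct image $f(R)$ is the image of $R\rightarrowtail X\times X\xrightarrow{f\times f}Y\times Y$. For reflexive relations $R,S$ on $X$, $(R,S)_n$ is the alternating product of $n$ factors beginning with $R$: $(R,S)_1=R$, $(R,S)_2=RS$, $(R,S)_3=RSR$, etc. A regular category is congruence $n$-permutable when $(R,S)_n=(S,R)_n$ for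 any pair $(R,S)$ of equivalence relations on the same object. $Equ\,\mathbb{E}$ is the category whose objects are pairs (object $X$, equivalence relation $R$ on $X$) and in which a morphism $R\to S$ above $f:X\to Y$ exists (and is unique) iff $R\subset f^{-1}(S)$, where $f^{-1}(S)$ is the pullback of $S$ along $f\times f$; $(\;)_0$ sends $R$ to its ground object. Given a functor $U:\mathbb{C}\to\mathbb{D}$, a map $f:X\to Z$ of $\mathbb{C}$ is cocartesian with respect to $U$ when, for every $\phi:X\to W$ with $U(\phi)=U(f)$, there is a unique $\psi:Z\to W$ with $\psi f=\phi$ and $U(\psi)=1_{U(Z)}$. *)

theory Defs
  imports Main
begin

section \<open>Categories\<close>

record ('o, 'a) cat =
  Obj :: "'o set"
  Arr :: "'a set"
  Dom :: "'a \<Rightarrow> 'o"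
  Cod :: "'a \<Rightarrow> 'o"
  Ident :: "'o \<Rightarrow> 'a"
  Comp :: "'a \<Rightarrow> 'a \<Rightarrow> 'a" (infixl "\<cdot>\<index>" 70)

definition hom :: "('o, 'a, 'c) cat_scheme \<Rightarrow> 'o \<Rightarrow> 'o \<Rightarrow> 'a set" where
  "hom C X Y = {f \<in> Arr C. Dom C f = X \<and> Cod C f = Y}"

locale category =
  fixes C :: "('o, 'a, 'c) cat_scheme" (structure)
  assumes Dom_Obj: "f \<in> Arr C \<Longrightarrow> Dom C f \<in> Obj C"
    and Cod_Obj: "f \<in> Arr C \<Longrightarrow> Cod C f \<in> Obj C"
    and Ident_hom: "X \<in> Obj C \<Longrightarrow> Ident C X \<in> hom C X X"
    and Comp_hom: "\<lbrakk>f \<in> hom C X Y; g \<in> hom C Y Z\<rbrakk> \<Longrightarrow> g \<cdot> f \<in> hom C X Z"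
    and Comp_assoc: "\<lbrakk>f \<in> hom C X Y; g \<in> hom C Y Z; h \<in> hom C Z W\<rbrakk>
                      \<Longrightarrow> h \<cdot> (g \<cdot> f) = (h \<cdot> g) \<cdot> f"
    and Comp_Ident: "f \<in> hom C X Y \<Longrightarrow> f \<cdot> Ident C X = f"
    and Ident_Comp: "f \<in> hom C X Y \<Longrightarrow> Ident C Y \<cdot> f = f"

definition monic :: "('o, 'a, 'c) cat_scheme \<Rightarrow> 'a \<Rightarrow> bool" where
  "monic C m \<longleftrightarrow> m \<in> Arr C \<and>
     (\<forall>T. \<forall>u \<in> hom C T (Dom C m). \<forall>v \<in> hom C T (Dom C m).
        Comp C m u = Comp C m v \<longrightarrow> u = v)"

definition iso_arr :: "('o, 'a, 'c) cat_scheme \<Rightarrow> 'a \<Rightarrow> bool" where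
  "iso_arr C i \<longleftrightarrow> i \<in> Arr C \<and>
     (\<exists>j \<in> hom C (Cod C i) (Dom C i).
        Comp C j i = Ident C (Dom C i) \<and> Comp C i j = Ident C (Cod C i))"

definition coequalizer :: "('o, 'a, 'c) cat_scheme \<Rightarrow> 'a \<Rightarrow> 'a \<Rightarrow> 'a \<Rightarrow> bool" where
  "coequalizer C a b e \<longleftrightarrow>
     (\<exists>A X Q. a \<in> hom C A X \<and> b \<in> hom C A X \<and> e \<in> hom C X Q \<and>
        Comp C e a = Comp C e b \<and>
        (\<forall>Z. \<forall>h \<in> hom C X Z. Comp C h a = Comp C h b \<longrightarrow>
           (\<exists>!k. k \<in> hom C Q Z \<and> Comp C k e = h)))"

definition regular_epi :: "('o, 'a, 'c) cat_scheme \<Rightarrow> 'a \<Rightarrow> bool" where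
  "regular_epi C e \<longleftrightarrow> (\<exists>a b. coequalizer C a b e)"

definition terminal_obj :: "('o, 'a, 'c) cat_scheme \<Rightarrow> 'o \<Rightarrow> bool" where
  "terminal_obj C T \<longleftrightarrow> T \<in> Obj C \<and> (\<forall>X \<in> Obj C. \<exists>!t. t \<in> hom C X T)"

text \<open>The square \<open>f \<cdot> a = g \<cdot> b\<close> is a pullback.\<close>

definition pullback :: "('o, 'a, 'c) cat_scheme \<Rightarrow> 'a \<Rightarrow> 'a \<Rightarrow> 'a \<Rightarrow> 'a \<Rightarrow> bool" where
  "pullback C f g a b \<longleftrightarrow>
     (\<exists>X Y Z P. f \<in> hom C X Z \<and> g \<in> hom C Y Z \<and> a \<in> hom C P X \<and> b \<in> hom C P Y \<and>
        Comp C f a = Comp C g b \<and>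
        (\<forall>T. \<forall>x \<in> hom C T X. \<forall>y \<in> hom C T Y. Comp C f x = Comp C g y \<longrightarrow>
           (\<exists>!h. h \<in> hom C T P \<and> Comp C a h = x \<and> Comp C b h = y)))"

text \<open>Finite completeness is expressed by a terminal object and pullbacks.\<close>

locale regular_category = category C
  for C :: "('o, 'a, 'c) cat_scheme" (structure) +
  assumes ex_terminal: "\<exists>T. terminal_obj C T"
    and ex_pullback: "\<lbrakk>f \<in> hom C X Z; g \<in> hom C Y Z\<rbrakk> \<Longrightarrow> \<exists>a b. pullback C f g a b"
    and ex_factorization: "f \<in> hom C X Y \<Longrightarrow>
          \<exists>I. \<exists>e \<in> hom C X I. \<exists>i \<in> hom C I Y. regular_epi C e \<and> monic C i \<and> i \<cdot> e = f"
    and regular_epi_stable: "\<lbrakk>pullback C f g a b; regular_epi C f\<rbrakk> \<Longrightarrow> regular_epi C b"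


section \<open>Binary products\<close>

definition product :: "('o, 'a, 'c) cat_scheme \<Rightarrow> 'o \<Rightarrow> 'o \<Rightarrow> 'a \<Rightarrow> 'a \<Rightarrow> bool" where
  "product C X Y p q \<longleftrightarrow>
     (\<exists>P. p \<in> hom C P X \<and> q \<in> hom C P Y \<and>
        (\<forall>T. \<forall>x \<in> hom C T X. \<forall>y \<in> hom C T Y.
           \<exists>!h. h \<in> hom C T P \<and> Comp C p h = x \<and> Comp C q h = y))"

text \<open>A product of \<open>X\<close> and \<open>Y\<close> is chosen once and for all; the choice is immaterial up to
  canonical isomorphism.\<close>

definition chosen_product :: "('o, 'a, 'c) cat_scheme \<Rightarrow> 'o \<Rightarrow> 'o \<Rightarrow> 'a \<times> 'a" where
  "chosen_product C X Y = (SOME (p, q). product C X Y p q)"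

definition pr1 :: "('o, 'a, 'c) cat_scheme \<Rightarrow> 'o \<Rightarrow> 'o \<Rightarrow> 'a" where
  "pr1 C X Y = fst (chosen_product C X Y)"

definition pr2 :: "('o, 'a, 'c) cat_scheme \<Rightarrow> 'o \<Rightarrow> 'o \<Rightarrow> 'a" where
  "pr2 C X Y = snd (chosen_product C X Y)"

definition Prod :: "('o, 'a, 'c) cat_scheme \<Rightarrow> 'o \<Rightarrow> 'o \<Rightarrow> 'o" where
  "Prod C X Y = Dom C (pr1 C X Y)"

text \<open>The arrow \<open>\<langle>a, b\<rangle> : T \<rightarrow> X \<times> Y\<close> for \<open>a : T \<rightarrow> X\<close> and \<open>b : T \<rightarrow> Y\<close>.\<close>

definition tuple :: "('o, 'a, 'c) cat_scheme \<Rightarrow> 'a \<Rightarrow> 'a \<Rightarrow> 'a" where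
  "tuple C a b =
     (let X = Cod C a; Y = Cod C b in
      THE h. h \<in> hom C (Dom C a) (Prod C X Y) \<and>
             Comp C (pr1 C X Y) h = a \<and> Comp C (pr2 C X Y) h = b)"

text \<open>\<open>f \<times> f : X \<times> X \<rightarrow> Y \<times> Y\<close> for \<open>f : X \<rightarrow> Y\<close>.\<close>

definition square_map :: "('o, 'a, 'c) cat_scheme \<Rightarrow> 'a \<Rightarrow> 'a" where
  "square_map C f =
     (let X = Dom C f in tuple C (Comp C f (pr1 C X X)) (Comp C f (pr2 C X X)))"


section \<open>Subobjects\<close>

text \<open>A subobject is the full isomorphism class of a monomorphism, so that equality of
  subobjects is equality of sets.\<close>

definition sub_class :: "('o, 'a, 'c) cat_scheme \<Rightarrow> 'a \<Rightarrow> 'a set" where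
  "sub_class C r = {s. monic C s \<and> Cod C s = Cod C r \<and>
     (\<exists>i \<in> hom C (Dom C s) (Dom C r). iso_arr C i \<and> Comp C r i = s)}"

definition subobject :: "('o, 'a, 'c) cat_scheme \<Rightarrow> 'o \<Rightarrow> 'a set \<Rightarrow> bool" where
  "subobject C A R \<longleftrightarrow> (\<exists>r. monic C r \<and> Cod C r = A \<and> R = sub_class C r)"

definition sub_le :: "('o, 'a, 'c) cat_scheme \<Rightarrow> 'a set \<Rightarrow> 'a set \<Rightarrow> bool" where
  "sub_le C R S \<longleftrightarrow>
     (\<exists>r \<in> R. \<exists>s \<in> S. \<exists>h \<in> hom C (Dom C r) (Dom C s). Comp C s h = r)"

text \<open>The image of an arrow, as a subobject of its codomain: all the monomorphic parts of its
  regular epi-mono factorizations.\<close>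

definition arrow_image :: "('o, 'a, 'c) cat_scheme \<Rightarrow> 'a \<Rightarrow> 'a set" where
  "arrow_image C f = {i. monic C i \<and> Cod C i = Cod C f \<and>
     (\<exists>e \<in> hom C (Dom C f) (Dom C i). regular_epi C e \<and> Comp C i e = f)}"


section \<open>Relations\<close>

definition relation_on :: "('o, 'a, 'c) cat_scheme \<Rightarrow> 'o \<Rightarrow> 'a set \<Rightarrow> bool" where
  "relation_on C X R \<longleftrightarrow> X \<in> Obj C \<and> subobject C (Prod C X X) R"

definition diagonal :: "('o, 'a, 'c) cat_scheme \<Rightarrow> 'o \<Rightarrow> 'a set" where
  "diagonal C X = sub_class C (tuple C (Ident C X) (Ident C X))"

text \<open>The two legs of the span \<open>X \<leftarrow> R \<rightarrow> X\<close> underlying a monomorphism \<open>r : R \<rightarrow> X \<times> X\<close>.\<close>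

definition leg1 :: "('o, 'a, 'c) cat_scheme \<Rightarrow> 'o \<Rightarrow> 'a \<Rightarrow> 'a" where
  "leg1 C X r = Comp C (pr1 C X X) r"

definition leg2 :: "('o, 'a, 'c) cat_scheme \<Rightarrow> 'o \<Rightarrow> 'a \<Rightarrow> 'a" where
  "leg2 C X r = Comp C (pr2 C X X) r"

definition opposite :: "('o, 'a, 'c) cat_scheme \<Rightarrow> 'o \<Rightarrow> 'a set \<Rightarrow> 'a set" where
  "opposite C X R = (\<Union>r \<in> R. sub_class C (tuple C (leg2 C X r) (leg1 C X r)))"

text \<open>\<open>rel_comp C X S R\<close> is \<open>SR = S \<circ> R\<close>: first \<open>R\<close>, then \<open>S\<close>.\<close>

definition rel_comp :: "('o, 'a, 'c) cat_scheme \<Rightarrow> 'o \<Rightarrow> 'a set \<Rightarrow> 'a set \<Rightarrow> 'a set" where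
  "rel_comp C X S R =
     {t. \<exists>r \<in> R. \<exists>s \<in> S. \<exists>a b. pullback C (leg2 C X r) (leg1 C X s) a b \<and>
         t \<in> arrow_image C (tuple C (Comp C (leg1 C X r) a) (Comp C (leg2 C X s) b))}"

definition equivalence_on :: "('o, 'a, 'c) cat_scheme \<Rightarrow> 'o \<Rightarrow> 'a set \<Rightarrow> bool" where
  "equivalence_on C X R \<longleftrightarrow> relation_on C X R \<and> sub_le C (diagonal C X) R \<and>
     sub_le C (opposite C X R) R \<and> sub_le C (rel_comp C X R R) R"

fun rel_power :: "('o, 'a, 'c) cat_scheme \<Rightarrow> 'o \<Rightarrow> 'a set \<Rightarrow> nat \<Rightarrow> 'a set" where
  "rel_power C X R 0 = diagonal C X"
| "rel_power C X R (Suc 0) = R"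
| "rel_power C X R (Suc (Suc n)) = rel_comp C X R (rel_power C X R (Suc n))"

text \<open>\<open>alternating C X R S n\<close> is \<open>(R, S)\<^sub>n = RSR\<dots>\<close>, with \<open>n\<close> factors, the leftmost one
  being \<open>R\<close>. The value at \<open>n = 0\<close> is a convention.\<close>

fun alternating :: "('o, 'a, 'c) cat_scheme \<Rightarrow> 'o \<Rightarrow> 'a set \<Rightarrow> 'a set \<Rightarrow> nat \<Rightarrow> 'a set" where
  "alternating C X R S 0 = diagonal C X"
| "alternating C X R S (Suc 0) = R"
| "alternating C X R S (Suc (Suc n)) = rel_comp C X R (alternating C X S R (Suc n))"

definition congruence_permutable :: "('o, 'a, 'c) cat_scheme \<Rightarrow> nat \<Rightarrow> bool" where
  "congruence_permutable C n \<longleftrightarrow>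
     (\<forall>X R S. equivalence_on C X R \<and> equivalence_on C X S \<longrightarrow>
        alternating C X R S n = alternating C X S R n)"

definition direct_image :: "('o, 'a, 'c) cat_scheme \<Rightarrow> 'a \<Rightarrow> 'a set \<Rightarrow> 'a set" where
  "direct_image C f R = (\<Union>r \<in> R. arrow_image C (Comp C (square_map C f) r))"

definition inverse_image :: "('o, 'a, 'c) cat_scheme \<Rightarrow> 'a \<Rightarrow> 'a set \<Rightarrow> 'a set" where
  "inverse_image C f S = {t. \<exists>s \<in> S. \<exists>k. pullback C (square_map C f) s t k}"


section \<open>Functors and cocartesian arrows\<close>

record ('o, 'a, 'p, 'b) cat_functor =
  on_obj :: "'o \<Rightarrow> 'p"
  on_arr :: "'a \<Rightarrow> 'b"

locale functor_between = dom: category C + cod: category D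
  for C :: "('o, 'a, 'c) cat_scheme" and D :: "('p, 'b, 'd) cat_scheme" +
  fixes U :: "('o, 'a, 'p, 'b) cat_functor"
  assumes on_obj_Obj: "X \<in> Obj C \<Longrightarrow> on_obj U X \<in> Obj D"
    and on_arr_hom: "f \<in> hom C X Y \<Longrightarrow> on_arr U f \<in> hom D (on_obj U X) (on_obj U Y)"
    and on_arr_Ident: "X \<in> Obj C \<Longrightarrow> on_arr U (Ident C X) = Ident D (on_obj U X)"
    and on_arr_Comp: "\<lbrakk>f \<in> hom C X Y; g \<in> hom C Y Z\<rbrakk>
           \<Longrightarrow> on_arr U (Comp C g f) = Comp D (on_arr U g) (on_arr U f)"

definition cocartesian ::
    "('o, 'a, 'c) cat_scheme \<Rightarrow> ('p, 'b, 'd) cat_scheme \<Rightarrow> ('o, 'a, 'p, 'b) cat_functor \<Rightarrow> 'a \<Rightarrow> bool"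
  where
  "cocartesian C D U f \<longleftrightarrow> f \<in> Arr C \<and>
     (\<forall>W. \<forall>\<phi> \<in> hom C (Dom C f) W. on_arr U \<phi> = on_arr U f \<longrightarrow>
        (\<exists>!\<psi>. \<psi> \<in> hom C (Cod C f) W \<and> Comp C \<psi> f = \<phi> \<and>
              on_arr U \<psi> = Ident D (on_obj U (Cod C f))))"


section \<open>The category of equivalence relations\<close>

type_synonym ('o, 'a) eq_obj = "'o \<times> 'a set"

text \<open>An arrow carries its source and target, since an arrow of the base category may underlie
  arrows between several pairs of equivalence relations.\<close>

type_synonym ('o, 'a) eq_arr = "('o, 'a) eq_obj \<times> 'a \<times> ('o, 'a) eq_obj"

definition Equ :: "('o, 'a, 'c) cat_scheme \<Rightarrow> (('o, 'a) eq_obj, ('o, 'a) eq_arr) cat" where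
  "Equ C = \<lparr>
     Obj = {(X, R). equivalence_on C X R},
     Arr = {((X, R), f, (Y, S)). equivalence_on C X R \<and> equivalence_on C Y S \<and>
              f \<in> hom C X Y \<and> sub_le C R (inverse_image C f S)},
     Dom = (\<lambda>(A, f, B). A),
     Cod = (\<lambda>(A, f, B). B),
     Ident = (\<lambda>A. (A, Ident C (fst A), A)),
     Comp = (\<lambda>(B', g, D) (A, f, B). (A, Comp C g f, D))\<rparr>"

definition ground :: "(('o, 'a) eq_obj, ('o, 'a) eq_arr, 'o, 'a) cat_functor" where
  "ground = \<lparr>on_obj = fst, on_arr = (\<lambda>(A, f, B). f)\<rparr>"


section \<open>The ground object functor is a functor\<close>

context category begin

lemma homD: "f \<in> hom C X Y \<Longrightarrow> f \<in> Arr C \<and> Dom C f = X \<and> Cod C f = Y \<and> X \<in> Obj C \<and> Y \<in> Obj C"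
  using Dom_Obj Cod_Obj by (auto simp: hom_def)

lemma homI: "f \<in> Arr C \<Longrightarrow> f \<in> hom C (Dom C f) (Cod C f)"
  by (simp add: hom_def)

lemma pullbackD:
  assumes pb: "pullback C f g a b" and f: "f \<in> hom C X Z" and g: "g \<in> hom C Y Z"
  shows "a \<in> hom C (Dom C a) X" "b \<in> hom C (Dom C a) Y" "f \<cdot> a = g \<cdot> b"
    "\<lbrakk>x \<in> hom C T X; y \<in> hom C T Y; f \<cdot> x = g \<cdot> y\<rbrakk>
       \<Longrightarrow> \<exists>!h. h \<in> hom C T (Dom C a) \<and> a \<cdot> h = x \<and> b \<cdot> h = y"
proof -
  obtain X' Y' Z' P where 1: "f \<in> hom C X' Z'" "g \<in> hom C Y' Z'" "a \<in> hom C P X'" "b \<in> hom C P Y'"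
    "f \<cdot> a = g \<cdot> b"
    and 2: "\<forall>T. \<forall>x \<in> hom C T X'. \<forall>y \<in> hom C T Y'. f \<cdot> x = g \<cdot> y \<longrightarrow>
           (\<exists>!h. h \<in> hom C T P \<and> a \<cdot> h = x \<and> b \<cdot> h = y)"
    using pb unfolding pullback_def by blast
  have e: "X' = X" "Y' = Y" "P = Dom C a" using homD f g 1 by metis+
  show "a \<in> hom C (Dom C a) X" "b \<in> hom C (Dom C a) Y" "f \<cdot> a = g \<cdot> b" using 1 e by auto
  show "\<lbrakk>x \<in> hom C T X; y \<in> hom C T Y; f \<cdot> x = g \<cdot> y\<rbrakk>
       \<Longrightarrow> \<exists>!h. h \<in> hom C T (Dom C a) \<and> a \<cdot> h = x \<and> b \<cdot> h = y" using 2 e by blast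
qed

lemma subobject_compare:
  assumes R: "subobject C A R" and r: "r \<in> R" and r': "r' \<in> R"
  shows "\<exists>h \<in> hom C (Dom C r') (Dom C r). r \<cdot> h = r'"
proof -
  obtain r0 where r0: "monic C r0" "Cod C r0 = A" "R = sub_class C r0"
    using R by (auto simp: subobject_def)
  obtain i where i: "i \<in> hom C (Dom C r) (Dom C r0)" "iso_arr C i" "r0 \<cdot> i = r"
    using r r0 by (auto simp: sub_class_def)
  obtain i' where i': "i' \<in> hom C (Dom C r') (Dom C r0)" "r0 \<cdot> i' = r'"
    using r' r0 by (auto simp: sub_class_def)
  obtain j where j: "j \<in> hom C (Dom C r0) (Dom C r)" "i \<cdot> j = Ident C (Dom C r0)"
    using i homD[OF i(1)] by (auto simp: iso_arr_def)
  have r0h: "r0 \<in> hom C (Dom C r0) A" using r0 homI by (auto simp: monic_def)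
  have ji: "j \<cdot> i' \<in> hom C (Dom C r') (Dom C r)" using Comp_hom i'(1) j(1) by blast
  have "r \<cdot> (j \<cdot> i') = r0 \<cdot> (i \<cdot> (j \<cdot> i'))"
    using Comp_assoc[OF ji i(1) r0h] i(3) by simp
  also have "i \<cdot> (j \<cdot> i') = i'"
    using Comp_assoc[OF i'(1) j(1) i(1)] j(2) Ident_Comp[OF i'(1)] by simp
  finally show ?thesis using ji i' by auto
qed

lemma subobject_mem: "subobject C A R \<Longrightarrow> r \<in> R \<Longrightarrow> monic C r \<and> r \<in> hom C (Dom C r) A"
  by (auto simp: subobject_def sub_class_def monic_def hom_def)

lemma subobject_nonempty: assumes "subobject C A R" shows "\<exists>r. r \<in> R"
proof -
  obtain r where r: "monic C r" "Cod C r = A" "R = sub_class C r"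
    using assms by (auto simp: subobject_def)
  have rh: "r \<in> hom C (Dom C r) A" using r homI by (auto simp: monic_def)
  have I: "Ident C (Dom C r) \<in> hom C (Dom C r) (Dom C r)" using homD[OF rh] Ident_hom by blast
  have "iso_arr C (Ident C (Dom C r))"
    using I homD[OF I] Comp_Ident[OF I] by (auto simp: iso_arr_def)
  then have "r \<in> R" using r I Comp_Ident[OF rh] by (auto simp: sub_class_def)
  then show ?thesis ..
qed

end

context regular_category begin

lemma ex_product:
  assumes "X \<in> Obj C" "Y \<in> Obj C"
  shows "\<exists>p q. product C X Y p q"
proof -
  obtain T where T: "T \<in> Obj C" "\<And>X. X \<in> Obj C \<Longrightarrow> \<exists>!t. t \<in> hom C X T"
    using ex_terminal by (auto simp: terminal_obj_def)
  obtain x y where x: "x \<in> hom C X T" and y: "y \<in> hom C Y T" using T assms by metis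
  obtain p q where pq: "pullback C x y p q" using ex_pullback[OF x y] by blast
  define P where "P = Dom C p"
  note P = pullbackD(1,2)[OF pq x y, folded P_def] and u = pullbackD(4)[OF pq x y, folded P_def]
  have "\<exists>!h. h \<in> hom C S P \<and> p \<cdot> h = a \<and> q \<cdot> h = b" if "a \<in> hom C S X" "b \<in> hom C S Y" for S a b
  proof -
    have "x \<cdot> a \<in> hom C S T" "y \<cdot> b \<in> hom C S T" using Comp_hom that x y by blast+
    then have "x \<cdot> a = y \<cdot> b" using T homD[OF that(1)] by blast
    then show ?thesis using u that by blast
  qed
  then show ?thesis using P unfolding product_def by blast
qed

lemma product_chosen:
  assumes "X \<in> Obj C" "Y \<in> Obj C"
  shows "product C X Y (pr1 C X Y) (pr2 C X Y)"
proof -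
  have "\<exists>z. (case z of (p, q) \<Rightarrow> product C X Y p q)" using ex_product[OF assms] by auto
  then show ?thesis unfolding pr1_def pr2_def chosen_product_def
    by (metis (mono_tags, lifting) case_prod_unfold someI_ex)
qed

lemma pr_hom:
  assumes "X \<in> Obj C" "Y \<in> Obj C"
  shows "pr1 C X Y \<in> hom C (Prod C X Y) X" "pr2 C X Y \<in> hom C (Prod C X Y) Y"
  using product_chosen[OF assms] homD by (auto simp: product_def Prod_def)

lemma product_universal:
  assumes "a \<in> hom C T X" "b \<in> hom C T Y"
  shows "\<exists>!h. h \<in> hom C T (Prod C X Y) \<and> pr1 C X Y \<cdot> h = a \<and> pr2 C X Y \<cdot> h = b"
proof -
  have XY: "X \<in> Obj C" "Y \<in> Obj C" using assms homD by auto
  obtain P where P: "pr1 C X Y \<in> hom C P X"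
    and u: "\<And>T x y. x \<in> hom C T X \<Longrightarrow> y \<in> hom C T Y \<Longrightarrow>
      \<exists>!h. h \<in> hom C T P \<and> pr1 C X Y \<cdot> h = x \<and> pr2 C X Y \<cdot> h = y"
    using product_chosen[OF XY] unfolding product_def by blast
  have "P = Prod C X Y" using P homD by (auto simp: Prod_def)
  then show ?thesis using u assms by blast
qed

lemma tuple_props:
  assumes "a \<in> hom C T X" "b \<in> hom C T Y"
  shows "tuple C a b \<in> hom C T (Prod C X Y)" "pr1 C X Y \<cdot> tuple C a b = a"
    "pr2 C X Y \<cdot> tuple C a b = b"
proof -
  have "tuple C a b = (THE h. h \<in> hom C T (Prod C X Y) \<and> pr1 C X Y \<cdot> h = a \<and> pr2 C X Y \<cdot> h = b)"
    using assms homD by (auto simp: tuple_def Let_def)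
  then have "tuple C a b \<in> hom C T (Prod C X Y) \<and> pr1 C X Y \<cdot> tuple C a b = a \<and> pr2 C X Y \<cdot> tuple C a b = b"
    using theI'[OF product_universal[OF assms]] by simp
  then show "tuple C a b \<in> hom C T (Prod C X Y)" "pr1 C X Y \<cdot> tuple C a b = a"
    "pr2 C X Y \<cdot> tuple C a b = b" by auto
qed

lemma product_ext:
  assumes "X \<in> Obj C" "Y \<in> Obj C" "h \<in> hom C T (Prod C X Y)" "k \<in> hom C T (Prod C X Y)"
    "pr1 C X Y \<cdot> h = pr1 C X Y \<cdot> k" "pr2 C X Y \<cdot> h = pr2 C X Y \<cdot> k"
  shows "h = k"
proof -
  have "pr1 C X Y \<cdot> k \<in> hom C T X" "pr2 C X Y \<cdot> k \<in> hom C T Y"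
    using assms Comp_hom pr_hom by blast+
  from product_universal[OF this] show ?thesis using assms by metis
qed

lemma square_map_props:
  assumes f: "f \<in> hom C X Y"
  shows "square_map C f \<in> hom C (Prod C X X) (Prod C Y Y)"
    "pr1 C Y Y \<cdot> square_map C f = f \<cdot> pr1 C X X"
    "pr2 C Y Y \<cdot> square_map C f = f \<cdot> pr2 C X X"
proof -
  have X: "X \<in> Obj C" using homD[OF f] by simp
  have h: "f \<cdot> pr1 C X X \<in> hom C (Prod C X X) Y" "f \<cdot> pr2 C X X \<in> hom C (Prod C X X) Y"
    using Comp_hom f pr_hom[OF X X] by blast+
  have "square_map C f = tuple C (f \<cdot> pr1 C X X) (f \<cdot> pr2 C X X)"
    using homD[OF f] by (simp add: square_map_def Let_def)
  then show "square_map C f \<in> hom C (Prod C X X) (Prod C Y Y)"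
    "pr1 C Y Y \<cdot> square_map C f = f \<cdot> pr1 C X X"
    "pr2 C Y Y \<cdot> square_map C f = f \<cdot> pr2 C X X"
    using tuple_props[OF h] by simp_all
qed

lemma square_map_Ident:
  assumes X: "X \<in> Obj C" shows "square_map C (Ident C X) = Ident C (Prod C X X)"
proof -
  note I = Ident_hom[OF X]
  have P: "Prod C X X \<in> Obj C" using pr_hom[OF X X] homD by blast
  show ?thesis
    using product_ext[OF X X square_map_props(1)[OF I] Ident_hom[OF P]]
      square_map_props(2,3)[OF I] Comp_Ident Ident_Comp pr_hom[OF X X] by metis
qed

lemma square_map_Comp:
  assumes f: "f \<in> hom C X Y" and g: "g \<in> hom C Y Z"
  shows "square_map C (g \<cdot> f) = square_map C g \<cdot> square_map C f"
proof -
  have O: "X \<in> Obj C" "Y \<in> Obj C" "Z \<in> Obj C" using f g homD by auto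
  note gf = Comp_hom[OF f g]
  note sf = square_map_props[OF f] and sg = square_map_props[OF g] and sgf = square_map_props[OF gf]
  note pX = pr_hom[OF O(1,1)] and pY = pr_hom[OF O(2,2)] and pZ = pr_hom[OF O(3,3)]
  have "pr1 C Z Z \<cdot> square_map C (g \<cdot> f) = pr1 C Z Z \<cdot> (square_map C g \<cdot> square_map C f)"
    using Comp_assoc[OF sf(1) sg(1) pZ(1)] Comp_assoc[OF sf(1) pY(1) g] Comp_assoc[OF pX(1) f g]
      sf sg sgf by simp
  moreover have "pr2 C Z Z \<cdot> square_map C (g \<cdot> f) = pr2 C Z Z \<cdot> (square_map C g \<cdot> square_map C f)"
    using Comp_assoc[OF sf(1) sg(1) pZ(2)] Comp_assoc[OF sf(1) pY(2) g] Comp_assoc[OF pX(2) f g]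
      sf sg sgf by simp
  ultimately show ?thesis
    using product_ext[OF O(3,3) sgf(1) Comp_hom[OF sf(1) sg(1)]] by blast
qed

lemma sub_le_inverse_image:
  assumes f: "f \<in> hom C X Y" and R: "relation_on C X R" and S: "relation_on C Y S"
  shows "sub_le C R (inverse_image C f S) \<longleftrightarrow>
    (\<forall>r \<in> R. \<forall>s \<in> S. \<exists>h \<in> hom C (Dom C r) (Dom C s). s \<cdot> h = square_map C f \<cdot> r)"
    (is "?L \<longleftrightarrow> ?R")
proof
  note sR = R[unfolded relation_on_def, THEN conjunct2]
  note sS = S[unfolded relation_on_def, THEN conjunct2]
  note sf = square_map_props(1)[OF f]
  {
    assume ?L
    then obtain r0 s0 t k h0 where 0: "r0 \<in> R" "s0 \<in> S" "pullback C (square_map C f) s0 t k"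
      "h0 \<in> hom C (Dom C r0) (Dom C t)" "t \<cdot> h0 = r0"
      by (auto simp: sub_le_def inverse_image_def)
    have s0: "s0 \<in> hom C (Dom C s0) (Prod C Y Y)" using subobject_mem[OF sS 0(2)] by simp
    have tk: "square_map C f \<cdot> t = s0 \<cdot> k" "t \<in> hom C (Dom C t) (Prod C X X)"
      "k \<in> hom C (Dom C t) (Dom C s0)"
      using pullbackD[OF 0(3) sf s0] by auto
    show ?R
    proof (intro ballI)
      fix r s assume rs: "r \<in> R" "s \<in> S"
      obtain u where u: "u \<in> hom C (Dom C r) (Dom C r0)" "r0 \<cdot> u = r"
        using subobject_compare[OF sR 0(1) rs(1)] by blast
      obtain v where v: "v \<in> hom C (Dom C s0) (Dom C s)" "s \<cdot> v = s0"
        using subobject_compare[OF sS rs(2) 0(2)] by blast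
      have s: "s \<in> hom C (Dom C s) (Prod C Y Y)" using subobject_mem[OF sS rs(2)] by simp
      have r: "r0 \<in> hom C (Dom C r0) (Prod C X X)" using subobject_mem[OF sR 0(1)] by simp
      have hu: "h0 \<cdot> u \<in> hom C (Dom C r) (Dom C t)" using Comp_hom u(1) 0(4) by blast
      have khu: "k \<cdot> (h0 \<cdot> u) \<in> hom C (Dom C r) (Dom C s0)" using Comp_hom hu tk(3) by blast
      have "s \<cdot> (v \<cdot> (k \<cdot> (h0 \<cdot> u))) = s0 \<cdot> (k \<cdot> (h0 \<cdot> u))"
        using Comp_assoc[OF khu v(1) s] v(2) by simp
      also have "\<dots> = square_map C f \<cdot> (t \<cdot> (h0 \<cdot> u))"
        using Comp_assoc[OF hu tk(3) s0] Comp_assoc[OF hu tk(2) sf] tk(1) by simp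
      also have "t \<cdot> (h0 \<cdot> u) = r"
        using Comp_assoc[OF u(1) 0(4) tk(2)] 0(5) u(2) by simp
      finally show "\<exists>h \<in> hom C (Dom C r) (Dom C s). s \<cdot> h = square_map C f \<cdot> r"
        using Comp_hom[OF khu v(1)] by blast
    qed
  }
  {
    assume ?R
    obtain r s where rs: "r \<in> R" "s \<in> S" using subobject_nonempty sR sS by blast
    then obtain h where h: "h \<in> hom C (Dom C r) (Dom C s)" "square_map C f \<cdot> r = s \<cdot> h"
      using \<open>?R\<close> by metis
    have s: "s \<in> hom C (Dom C s) (Prod C Y Y)" using subobject_mem[OF sS rs(2)] by simp
    have r: "r \<in> hom C (Dom C r) (Prod C X X)" using subobject_mem[OF sR rs(1)] by simp
    obtain t k where tk: "pullback C (square_map C f) s t k" using ex_pullback[OF sf s] by blast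
    have "\<exists>l. l \<in> hom C (Dom C r) (Dom C t) \<and> t \<cdot> l = r"
      using pullbackD(4)[OF tk sf s r h] by blast
    then show ?L using rs tk by (auto simp: sub_le_def inverse_image_def)
  }
qed

lemma Equ_hom: "\<phi> \<in> hom (Equ C) A B \<longleftrightarrow> (\<exists>f. \<phi> = (A, f, B) \<and> equivalence_on C (fst A) (snd A)
   \<and> equivalence_on C (fst B) (snd B) \<and> f \<in> hom C (fst A) (fst B)
   \<and> sub_le C (snd A) (inverse_image C f (snd B)))"
  by (auto simp: hom_def Equ_def)

lemma equivalence_relation_on: "equivalence_on C X R \<Longrightarrow> relation_on C X R"
  by (simp add: equivalence_on_def)

lemma functor_ground: "functor_between (Equ C) C ground"
proof -
  have id: "sub_le C R (inverse_image C (Ident C X) R)" if E: "equivalence_on C X R" for X R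
  proof -
    note R = equivalence_relation_on[OF E]
    have X: "X \<in> Obj C" and sR: "subobject C (Prod C X X) R" using R by (auto simp: relation_on_def)
    have "\<exists>h \<in> hom C (Dom C r) (Dom C s). s \<cdot> h = square_map C (Ident C X) \<cdot> r"
      if "r \<in> R" "s \<in> R" for r s
    proof -
      have "r \<in> hom C (Dom C r) (Prod C X X)" using subobject_mem[OF sR that(1)] by blast
      then show ?thesis
        using subobject_compare[OF sR that(2,1)] square_map_Ident[OF X] Ident_Comp by simp
    qed
    then show ?thesis using sub_le_inverse_image[OF Ident_hom[OF X] R R] by blast
  qed
  have comp: "sub_le C R (inverse_image C (g \<cdot> f) T)"
    if E: "equivalence_on C X R" "equivalence_on C Y S" "equivalence_on C Z T"
      and f: "f \<in> hom C X Y" and g: "g \<in> hom C Y Z"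
      and le: "sub_le C R (inverse_image C f S)" "sub_le C S (inverse_image C g T)"
    for X Y Z R S T f g
  proof -
    note rel = E[THEN equivalence_relation_on]
    note sf = square_map_props(1)[OF f] and sg = square_map_props(1)[OF g]
    have sub: "subobject C (Prod C X X) R" "subobject C (Prod C Y Y) S" "subobject C (Prod C Z Z) T"
      using rel by (auto simp: relation_on_def)
    have "\<exists>h \<in> hom C (Dom C r) (Dom C t). t \<cdot> h = square_map C (g \<cdot> f) \<cdot> r"
      if rt: "r \<in> R" "t \<in> T" for r t
    proof -
      obtain s where s: "s \<in> S" using subobject_nonempty[OF sub(2)] ..
      obtain h where h: "h \<in> hom C (Dom C r) (Dom C s)" "s \<cdot> h = square_map C f \<cdot> r"
        using le(1) sub_le_inverse_image[OF f rel(1,2)] rt s by blast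
      obtain k where k: "k \<in> hom C (Dom C s) (Dom C t)" "t \<cdot> k = square_map C g \<cdot> s"
        using le(2) sub_le_inverse_image[OF g rel(2,3)] rt s by blast
      have rh: "r \<in> hom C (Dom C r) (Prod C X X)" and sh: "s \<in> hom C (Dom C s) (Prod C Y Y)"
        and th: "t \<in> hom C (Dom C t) (Prod C Z Z)"
        using subobject_mem sub rt s by blast+
      have "t \<cdot> (k \<cdot> h) = square_map C g \<cdot> (s \<cdot> h)"
        using Comp_assoc[OF h(1) k(1) th] Comp_assoc[OF h(1) sh sg] k(2) by simp
      also have "\<dots> = square_map C (g \<cdot> f) \<cdot> r"
        using Comp_assoc[OF rh sf sg] h(2) square_map_Comp[OF f g] by simp
      finally show ?thesis using Comp_hom[OF h(1) k(1)] by blast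
    qed
    then show ?thesis using sub_le_inverse_image[OF Comp_hom[OF f g] rel(1,3)] by blast
  qed
  have obj: "X \<in> Obj C" if "equivalence_on C X R" for X R
    using that by (auto simp: equivalence_on_def relation_on_def)
  have cat: "category (Equ C)"
  proof
    show "Dom (Equ C) f \<in> Obj (Equ C)" "Cod (Equ C) f \<in> Obj (Equ C)" if "f \<in> Arr (Equ C)" for f
      using that by (auto simp: Equ_def)
    show "Ident (Equ C) A \<in> hom (Equ C) A A" if "A \<in> Obj (Equ C)" for A
      using that id[of "fst A" "snd A"] obj[of "fst A" "snd A"] Ident_hom[of "fst A"]
      unfolding Equ_hom by (auto simp: Equ_def)
    show "Comp (Equ C) g f \<in> hom (Equ C) A D"
      if fg: "f \<in> hom (Equ C) A B" "g \<in> hom (Equ C) B D" for f g A B D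
    proof -
      obtain f' g' where *: "f = (A, f', B)" "g = (B, g', D)"
        using fg unfolding Equ_hom by blast
      then have "Comp (Equ C) g f = (A, g' \<cdot> f', D)" by (simp add: Equ_def)
      then show ?thesis using fg unfolding Equ_hom *
        using comp[of "fst A" "snd A" "fst B" "snd B" "fst D" "snd D" f' g']
          Comp_hom[of f' "fst A" "fst B" g' "fst D"] by simp
    qed
    show "Comp (Equ C) h (Comp (Equ C) g f) = Comp (Equ C) (Comp (Equ C) h g) f"
      if "f \<in> hom (Equ C) A B" "g \<in> hom (Equ C) B D" "h \<in> hom (Equ C) D E" for f g h A B D E
      using that Comp_assoc unfolding Equ_hom by (auto simp: Equ_def)
    show "Comp (Equ C) f (Ident (Equ C) A) = f" "Comp (Equ C) (Ident (Equ C) B) f = f"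
      if "f \<in> hom (Equ C) A B" for f A B
      using that Comp_Ident Ident_Comp unfolding Equ_hom by (auto simp: Equ_def)
  qed
  show ?thesis
    unfolding functor_between_def functor_between_axioms_def
    using cat category_axioms obj
    by (auto simp: Equ_hom) (auto simp: Equ_def ground_def)
qed

end

end

theory Submission
  imports Defs
begin

text \<open>
  A relation \<open>R\<close> on \<open>X\<close> is determined by its generalized elements: the pairs \<open>(x, y)\<close> of arrows
  \<open>T \<rightarrow> X\<close> for which \<open>\<langle>x, y\<rangle>\<close> factors through \<open>R\<close>. These pairs form an ordinary set-theoretic
  relation \<open>pairs C X R\<close> between arrows. Passing to elements is not compatible with images, since
  an element of an image lifts only after composing with a regular epimorphism (a cover of its
  domain); the discrepancy is exactly \<open>local_closure\<close>, the closure of a set of pairs under being a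
  member locally. Thus a composite \<open>S R\<close> has as elements the local closure of
  \<open>pairs C X R O pairs C X S\<close> (\<open>rel_comp_relation\<close>), and, with \<open>F\<close> the graph \<open>x \<mapsto> f \<cdot> x\<close>, the direct
  image \<open>f(R)\<close> has as elements the local closure of \<open>F\<inverse> O pairs C X R O F\<close>
  (\<open>direct_image_relation\<close>). Since covers can be pulled back and composed, inner
  local closures may be dropped under an outer one (\<open>local_closure_relcomp\<close>). So every
  iterated product of relations in the category is one local closure of a product of plain relations, and the
  calculus of equivalence relations can be carried out with \<open>O\<close>, \<open>\<inverse>\<close> and \<open>^^\<close> of sets.

  Suppose \<open>2m+1\<close>-permutability, and let \<open>P\<close> be the elements of \<open>R\<close> and \<open>K = F O F\<inverse>\<close> those of the
  kernel equivalence of \<open>f\<close>. With \<open>A = F\<inverse> O P O F\<close> one has \<open>A ^^ (m+1) = F\<inverse> O (P K \<dots> P) O F\<close> with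
  \<open>2m+1\<close> factors in the middle. Locally these may be exchanged for \<open>K P \<dots> K\<close>, and the
  outer factors \<open>K\<close> are absorbed by \<open>F\<close>, which leaves \<open>A ^^ m\<close>. Hence the powers of \<open>f(R)\<close> stop growing
  at the \<open>m\<close>-th one, which is therefore transitive (\<open>direct_image_power_equivalence\<close>).

  Conversely, given equivalence relations \<open>R\<close> and \<open>S\<close> with legs \<open>d1, d2 : D \<rightarrow> X\<close> of \<open>R\<close>, the leg \<open>d2\<close> is
  a split, hence regular, epimorphism, and the direct image along \<open>d2\<close> of the
  inverse image of \<open>S\<close> along \<open>d1\<close> is \<open>R S R\<close>. Its \<open>m\<close>-th power is the alternating product of
  \<open>2m+1\<close> factors starting with \<open>R\<close>. If this is an equivalence relation, it contains \<open>R\<close> and \<open>S\<close>, so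
  also the alternating product starting with \<open>S\<close>; by symmetry the two coincide
  (\<open>permutable_if_direct_image_power_equivalence\<close>).

  The even case reduces to the odd one because \<open>n\<close>-permutability implies \<open>n+1\<close>-permutability
  (\<open>congruence_permutable_Suc\<close>). The same implication turns \<open>n\<close>-permutability into
  \<open>2n+1\<close>-permutability, and the equivalence relation \<open>f(R)\<^sup>n\<close> is then the least one on the codomain that
  contains \<open>f(R)\<close>, which is what a cocartesian lift of \<open>f\<close> at \<open>R\<close> has to be
  (\<open>cocartesian_direct_image\<close>).
\<close>

section \<open>Arrows and regular epimorphisms\<close>

context category begin

text \<open>Membership in hom-sets is split into equations between domains and codomains, so that the
  simplifier can discharge the typing conditions of associativity by rewriting.\<close>

lemma Comp_Arr [simp]:
  assumes "f \<in> Arr C" "g \<in> Arr C" "Cod C f = Dom C g"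
  shows "g \<cdot> f \<in> Arr C" "Dom C (g \<cdot> f) = Dom C f" "Cod C (g \<cdot> f) = Cod C g"
  using Comp_hom[of f "Dom C f" "Dom C g" g "Cod C g"] assms by (auto simp: hom_def)

lemma Comp_assoc_Arr [simp]:
  assumes "f \<in> Arr C" "g \<in> Arr C" "h \<in> Arr C" "Cod C f = Dom C g" "Cod C g = Dom C h"
  shows "(h \<cdot> g) \<cdot> f = h \<cdot> (g \<cdot> f)"
  using Comp_assoc[of f "Dom C f" "Dom C g" g "Dom C h" h "Cod C h"] assms by (auto simp: hom_def)

lemma Ident_Arr [simp]:
  assumes "X \<in> Obj C"
  shows "Ident C X \<in> Arr C" "Dom C (Ident C X) = X" "Cod C (Ident C X) = X"
  using Ident_hom[OF assms] by (auto simp: hom_def)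

lemma Comp_Ident_Arr [simp]:
  assumes "f \<in> Arr C"
  shows "f \<cdot> Ident C (Dom C f) = f" "Ident C (Cod C f) \<cdot> f = f"
  using assms Comp_Ident Ident_Comp by (auto simp: hom_def)

declare Dom_Obj [simp] Cod_Obj [simp]

lemma monicD:
  assumes "monic C m" "u \<in> Arr C" "v \<in> Arr C" "Cod C u = Dom C m" "Cod C v = Dom C m"
    "Dom C u = Dom C v" "m \<cdot> u = m \<cdot> v"
  shows "u = v"
  using assms unfolding monic_def hom_def by blast

lemma regular_epiE:
  assumes "regular_epi C e"
  obtains a b where "e \<in> Arr C" "a \<in> Arr C" "b \<in> Arr C" "Cod C a = Dom C e" "Cod C b = Dom C e"
    "Dom C a = Dom C b" "e \<cdot> a = e \<cdot> b"
    "\<And>h. h \<in> Arr C \<Longrightarrow> Dom C h = Dom C e \<Longrightarrow> h \<cdot> a = h \<cdot> b \<Longrightarrow>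
       \<exists>!k. k \<in> hom C (Cod C e) (Cod C h) \<and> k \<cdot> e = h"
proof -
  obtain a b A X Q where *: "a \<in> hom C A X" "b \<in> hom C A X" "e \<in> hom C X Q" "e \<cdot> a = e \<cdot> b"
    "\<forall>Z. \<forall>h \<in> hom C X Z. h \<cdot> a = h \<cdot> b \<longrightarrow> (\<exists>!k. k \<in> hom C Q Z \<and> k \<cdot> e = h)"
    using assms unfolding regular_epi_def coequalizer_def by blast
  show thesis
    by (rule that[of a b]) (use * in \<open>auto simp: hom_def\<close>)
qed

lemma regular_epiI:
  assumes "e \<in> Arr C" "a \<in> Arr C" "b \<in> Arr C" "Cod C a = Dom C e" "Cod C b = Dom C e"
    "Dom C a = Dom C b" "e \<cdot> a = e \<cdot> b"
    "\<And>h. h \<in> Arr C \<Longrightarrow> Dom C h = Dom C e \<Longrightarrow> h \<cdot> a = h \<cdot> b \<Longrightarrow>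
       \<exists>!k. k \<in> hom C (Cod C e) (Cod C h) \<and> k \<cdot> e = h"
  shows "regular_epi C e"
  unfolding regular_epi_def coequalizer_def
  by (rule exI[of _ a], rule exI[of _ b], rule exI[of _ "Dom C a"], rule exI[of _ "Dom C e"],
      rule exI[of _ "Cod C e"]) (use assms in \<open>auto simp: hom_def\<close>)

lemma regular_epi_Arr: "regular_epi C e \<Longrightarrow> e \<in> Arr C"
  by (metis regular_epiE)

lemma regular_epi_cancel:
  assumes e: "regular_epi C e" and "u \<in> Arr C" "v \<in> Arr C" "Dom C u = Cod C e" "Dom C v = Cod C e"
    "u \<cdot> e = v \<cdot> e"
  shows "u = v"
proof -
  obtain a b where ab: "e \<in> Arr C" "a \<in> Arr C" "b \<in> Arr C" "Cod C a = Dom C e" "Cod C b = Dom C e"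
    "e \<cdot> a = e \<cdot> b"
    and univ: "\<And>h. h \<in> Arr C \<Longrightarrow> Dom C h = Dom C e \<Longrightarrow> h \<cdot> a = h \<cdot> b \<Longrightarrow>
       \<exists>!k. k \<in> hom C (Cod C e) (Cod C h) \<and> k \<cdot> e = h"
    using e by (metis regular_epiE)
  have "(u \<cdot> e) \<cdot> a = (u \<cdot> e) \<cdot> b" using ab assms(2,4) by simp
  then have "\<exists>!k. k \<in> hom C (Cod C e) (Cod C u) \<and> k \<cdot> e = u \<cdot> e"
    using univ[of "u \<cdot> e"] ab assms(2,4) by simp
  moreover have "Cod C v = Cod C u"
    using arg_cong[OF assms(6), of "Cod C"] assms(2-5) ab by simp
  ultimately show ?thesis using assms by (auto simp: hom_def)
qed

text \<open>Regular epimorphisms are left orthogonal to monomorphisms: \<open>u\<close> coequalizes whatever \<open>e\<close> coequalizes,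
  because \<open>i\<close> is monic, and therefore factors through \<open>e\<close>.\<close>

lemma regular_epi_lift:
  assumes e: "regular_epi C e" and i: "monic C i"
    and u: "u \<in> Arr C" "Dom C u = Dom C e" "Cod C u = Dom C i"
    and v: "v \<in> Arr C" "Dom C v = Cod C e" "Cod C v = Cod C i"
    and sq: "i \<cdot> u = v \<cdot> e"
  obtains w where "w \<in> Arr C" "Dom C w = Cod C e" "Cod C w = Dom C i" "i \<cdot> w = v"
proof -
  obtain a b where ab: "e \<in> Arr C" "a \<in> Arr C" "b \<in> Arr C" "Cod C a = Dom C e" "Cod C b = Dom C e"
    "Dom C a = Dom C b" "e \<cdot> a = e \<cdot> b"
    and univ: "\<And>h. h \<in> Arr C \<Longrightarrow> Dom C h = Dom C e \<Longrightarrow> h \<cdot> a = h \<cdot> b \<Longrightarrow>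
       \<exists>!k. k \<in> hom C (Cod C e) (Cod C h) \<and> k \<cdot> e = h"
    using e by (metis regular_epiE)
  have i': "i \<in> Arr C" using i by (simp add: monic_def)
  have "i \<cdot> (u \<cdot> a) = (i \<cdot> u) \<cdot> a" using ab u i' by simp
  also have "\<dots> = (i \<cdot> u) \<cdot> b" unfolding sq using ab v by simp
  also have "\<dots> = i \<cdot> (u \<cdot> b)" using ab u i' by simp
  finally have "u \<cdot> a = u \<cdot> b" by (rule monicD[OF i, rotated -1]) (use ab u in simp_all)
  then obtain w where w: "w \<in> hom C (Cod C e) (Cod C u)" "w \<cdot> e = u" using univ[of u] u by blast
  have "(i \<cdot> w) \<cdot> e = v \<cdot> e" using w sq u i' ab by (simp add: hom_def)
  then have "i \<cdot> w = v"
    by (rule regular_epi_cancel[OF e, rotated -1]) (use w u v i' ab in \<open>simp_all add: hom_def\<close>)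
  then show thesis using that w u by (auto simp: hom_def)
qed

text \<open>A split epimorphism coequalizes the idempotent \<open>s \<cdot> d\<close> and the identity.\<close>

lemma split_epi_regular:
  assumes "d \<in> Arr C" "s \<in> Arr C" "Dom C s = Cod C d" "Cod C s = Dom C d"
    "d \<cdot> s = Ident C (Cod C d)"
  shows "regular_epi C d"
proof (rule regular_epiI[of d "s \<cdot> d" "Ident C (Dom C d)"])
  have "d \<cdot> (s \<cdot> d) = (d \<cdot> s) \<cdot> d" using assms(1-4) by (intro Comp_assoc_Arr[symmetric]) auto
  then show "d \<cdot> (s \<cdot> d) = d \<cdot> Ident C (Dom C d)" using assms by simp
  fix h assume h: "h \<in> Arr C" "Dom C h = Dom C d" "h \<cdot> (s \<cdot> d) = h \<cdot> Ident C (Dom C d)"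
  show "\<exists>!k. k \<in> hom C (Cod C d) (Cod C h) \<and> k \<cdot> d = h"
  proof (rule ex1I[of _ "h \<cdot> s"])
    have "h \<cdot> (s \<cdot> d) = h" using h Comp_Ident_Arr(1)[of h] by simp
    then show "h \<cdot> s \<in> hom C (Cod C d) (Cod C h) \<and> (h \<cdot> s) \<cdot> d = h"
      using assms h by (simp add: hom_def)
    fix k assume k: "k \<in> hom C (Cod C d) (Cod C h) \<and> k \<cdot> d = h"
    have "h \<cdot> s = (k \<cdot> d) \<cdot> s" using k by simp
    also have "\<dots> = k \<cdot> (d \<cdot> s)" using k assms(1-4) by (intro Comp_assoc_Arr) (auto simp: hom_def)
    also have "\<dots> = k" using k assms Comp_Ident_Arr(1)[of k] by (simp add: hom_def)
    finally show "k = h \<cdot> s" by simp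
  qed
qed (use assms in simp_all)

lemma Ident_regular_epi:
  assumes "X \<in> Obj C"
  shows "regular_epi C (Ident C X)"
  by (rule split_epi_regular[of _ "Ident C X"])
    (use assms Comp_Ident_Arr(1)[of "Ident C X"] in simp_all)

lemma regular_epi_Comp_iso:
  assumes q: "regular_epi C q" and i: "i \<in> Arr C" "Dom C i = Cod C q"
    and j: "j \<in> Arr C" "Dom C j = Cod C i" "Cod C j = Dom C i"
    and inv: "j \<cdot> i = Ident C (Dom C i)" "i \<cdot> j = Ident C (Cod C i)"
  shows "regular_epi C (i \<cdot> q)"
proof -
  obtain a b where ab: "q \<in> Arr C" "a \<in> Arr C" "b \<in> Arr C" "Cod C a = Dom C q" "Cod C b = Dom C q"
    "Dom C a = Dom C b" "q \<cdot> a = q \<cdot> b"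
    and univ: "\<And>h. h \<in> Arr C \<Longrightarrow> Dom C h = Dom C q \<Longrightarrow> h \<cdot> a = h \<cdot> b \<Longrightarrow>
       \<exists>!k. k \<in> hom C (Cod C q) (Cod C h) \<and> k \<cdot> q = h"
    using q by (metis regular_epiE)
  show ?thesis
  proof (rule regular_epiI[of _ a b])
    fix h assume h: "h \<in> Arr C" "Dom C h = Dom C (i \<cdot> q)" "h \<cdot> a = h \<cdot> b"
    then have h': "Dom C h = Dom C q" using ab i by simp
    obtain k where k: "k \<in> Arr C" "Dom C k = Cod C q" "Cod C k = Cod C h" "k \<cdot> q = h"
      using univ[OF h(1) h' h(3)] by (auto simp: hom_def)
    show "\<exists>!l. l \<in> hom C (Cod C (i \<cdot> q)) (Cod C h) \<and> l \<cdot> (i \<cdot> q) = h"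
    proof (rule ex1I[of _ "k \<cdot> j"])
      have "(k \<cdot> j) \<cdot> (i \<cdot> q) = k \<cdot> ((j \<cdot> i) \<cdot> q)"
        using k j i ab by (simp del: inv)
      also have "\<dots> = h" using inv i ab k by simp
      finally show "k \<cdot> j \<in> hom C (Cod C (i \<cdot> q)) (Cod C h) \<and> (k \<cdot> j) \<cdot> (i \<cdot> q) = h"
        using k j i ab by (simp add: hom_def)
      fix l assume l: "l \<in> hom C (Cod C (i \<cdot> q)) (Cod C h) \<and> l \<cdot> (i \<cdot> q) = h"
      then have l': "l \<in> Arr C" "Dom C l = Cod C i" "Cod C l = Cod C h"
        using i ab by (simp_all add: hom_def)
      have "(l \<cdot> i) \<cdot> q = k \<cdot> q" using l k l' i ab by simp
      then have "l \<cdot> i = k"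
        by (rule regular_epi_cancel[OF q, rotated -1]) (use l' i k in simp_all)
      then have "k \<cdot> j = l \<cdot> (i \<cdot> j)" using l' i j by auto
      also have "\<dots> = l" using inv l' Comp_Ident_Arr(1)[of l] by simp
      finally show "l = k \<cdot> j" by simp
    qed
  qed (use ab i in simp_all)
qed

end

context regular_category begin

lemma pullback_Arr:
  assumes "pullback C f g a b" "f \<in> Arr C" "g \<in> Arr C" "Cod C f = Cod C g"
  shows "a \<in> Arr C" "b \<in> Arr C" "Cod C a = Dom C f" "Cod C b = Dom C g" "Dom C b = Dom C a"
    "f \<cdot> a = g \<cdot> b"
    "\<lbrakk>x \<in> Arr C; y \<in> Arr C; Dom C x = Dom C y; Cod C x = Dom C f; Cod C y = Dom C g; f \<cdot> x = g \<cdot> y\<rbrakk>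
      \<Longrightarrow> \<exists>h. h \<in> Arr C \<and> Dom C h = Dom C x \<and> Cod C h = Dom C a \<and> a \<cdot> h = x \<and> b \<cdot> h = y"
    "\<lbrakk>u \<in> Arr C; v \<in> Arr C; Dom C u = Dom C v; Cod C u = Dom C a; Cod C v = Dom C a;
      a \<cdot> u = a \<cdot> v; b \<cdot> u = b \<cdot> v\<rbrakk> \<Longrightarrow> u = v"
proof -
  have fg: "f \<in> hom C (Dom C f) (Cod C f)" "g \<in> hom C (Dom C g) (Cod C f)"
    using assms by (auto simp: hom_def)
  note pb = pullbackD[OF assms(1) fg]
  show "a \<in> Arr C" "b \<in> Arr C" "Cod C a = Dom C f" "Cod C b = Dom C g" "Dom C b = Dom C a"
    "f \<cdot> a = g \<cdot> b" using pb(1-3) by (auto simp: hom_def)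
  note ab = this
  show "\<exists>h. h \<in> Arr C \<and> Dom C h = Dom C x \<and> Cod C h = Dom C a \<and> a \<cdot> h = x \<and> b \<cdot> h = y"
    if "x \<in> Arr C" "y \<in> Arr C" "Dom C x = Dom C y" "Cod C x = Dom C f" "Cod C y = Dom C g" "f \<cdot> x = g \<cdot> y"
    using pb(4)[of x "Dom C x" y] that by (auto simp: hom_def)
  show "u = v"
    if uv: "u \<in> Arr C" "v \<in> Arr C" "Dom C u = Dom C v" "Cod C u = Dom C a" "Cod C v = Dom C a"
      "a \<cdot> u = a \<cdot> v" "b \<cdot> u = b \<cdot> v"
  proof -
    have "f \<cdot> (a \<cdot> v) = (f \<cdot> a) \<cdot> v" "g \<cdot> (b \<cdot> v) = (g \<cdot> b) \<cdot> v"
      using ab(1-5) uv(2,5) assms by (auto intro: Comp_assoc_Arr[symmetric])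
    then have "\<exists>!h. h \<in> hom C (Dom C v) (Dom C a) \<and> a \<cdot> h = a \<cdot> v \<and> b \<cdot> h = b \<cdot> v"
      by (intro pb(4)) (use ab uv(2,5) in \<open>simp_all add: hom_def\<close>)
    then show ?thesis using uv by (auto simp: hom_def)
  qed
qed

lemma ex_pullback_Arr:
  assumes "f \<in> Arr C" "g \<in> Arr C" "Cod C f = Cod C g"
  shows "\<exists>a b. pullback C f g a b"
  using ex_pullback[of f "Dom C f" "Cod C f" g "Dom C g"] assms by (auto simp: hom_def)

lemma ex_factorization_Arr:
  assumes "f \<in> Arr C"
  obtains e i where "regular_epi C e" "monic C i" "i \<cdot> e = f" "Dom C e = Dom C f"
    "Cod C e = Dom C i" "Cod C i = Cod C f"
proof -
  obtain I e i where "e \<in> hom C (Dom C f) I" "i \<in> hom C I (Cod C f)"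
    "regular_epi C e" "monic C i" "i \<cdot> e = f"
    using ex_factorization[OF homI[OF assms]] by blast
  then show thesis using that by (auto simp only: hom_def mem_Collect_eq)
qed

text \<open>In the regular epi-mono factorization \<open>i \<cdot> q\<close> of the composite, orthogonality lifts the identity
  along \<open>i\<close> in two stages, first across \<open>e1\<close> and then across \<open>e2\<close>. So the monic part \<open>i\<close> is
  invertible.\<close>

lemma regular_epi_Comp:
  assumes e1: "regular_epi C e1" and e2: "regular_epi C e2" and c: "Cod C e1 = Dom C e2"
  shows "regular_epi C (e2 \<cdot> e1)"
proof -
  have A: "e1 \<in> Arr C" "e2 \<in> Arr C" using e1 e2 regular_epi_Arr by auto
  obtain q i where q: "regular_epi C q" and i: "monic C i" and qi: "i \<cdot> q = e2 \<cdot> e1"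
    "Dom C q = Dom C (e2 \<cdot> e1)" "Cod C q = Dom C i" "Cod C i = Cod C (e2 \<cdot> e1)"
    using ex_factorization_Arr[of "e2 \<cdot> e1"] A c by auto
  have A': "q \<in> Arr C" "i \<in> Arr C" using q i regular_epi_Arr by (auto simp: monic_def)
  have qi': "Dom C q = Dom C e1" "Cod C i = Cod C e2" using qi A c by simp_all
  obtain w1 where w1: "w1 \<in> Arr C" "Dom C w1 = Cod C e1" "Cod C w1 = Dom C i" "i \<cdot> w1 = e2"
    using regular_epi_lift[OF e1 i A'(1) qi'(1) qi(3) A(2) c[symmetric] qi'(2)[symmetric] qi(1)] .
  obtain j where j: "j \<in> Arr C" "Dom C j = Cod C e2" "Cod C j = Dom C i" "i \<cdot> j = Ident C (Cod C e2)"
    by (rule regular_epi_lift[OF e2 i w1(1), of "Ident C (Cod C e2)"]) (use w1 A A' qi' c in simp_all)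
  have "i \<cdot> (j \<cdot> i) = (i \<cdot> j) \<cdot> i" using j A' qi' by (intro Comp_assoc_Arr[symmetric]) auto
  also have "\<dots> = i \<cdot> Ident C (Dom C i)"
    unfolding j(4) qi'(2)[symmetric] using A' by simp
  finally have "j \<cdot> i = Ident C (Dom C i)"
    by (rule monicD[OF i, rotated -1]) (use j A' qi' in simp_all)
  then show ?thesis
    unfolding qi(1)[symmetric]
    by (intro regular_epi_Comp_iso[OF q A'(2) qi(3)[symmetric] j(1)]) (simp_all only: j qi')
qed

text \<open>A cover \<open>e\<close> of an object restricts along any arrow \<open>u\<close> into that object.\<close>

lemma cover_pullback:
  assumes "regular_epi C e" "u \<in> Arr C" "Cod C u = Cod C e"
  obtains e' v where "regular_epi C e'" "e' \<in> Arr C" "Cod C e' = Dom C u" "v \<in> Arr C" "Cod C v = Dom C e"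
    "Dom C v = Dom C e'" "u \<cdot> e' = e \<cdot> v"
proof -
  have e: "e \<in> Arr C" using assms(1) regular_epi_Arr by simp
  obtain a b where ab: "pullback C e u a b" using ex_pullback_Arr[of e u] e assms by auto
  show thesis
    by (rule that[of b a]) (simp_all only: pullback_Arr(1-6)[OF ab e assms(2) assms(3)[symmetric]]
        regular_epi_stable[OF ab assms(1)])
qed


end

section \<open>Stable families of pairs and their local closure\<close>

text \<open>A stable set of pairs is a subpresheaf of the presheaf of pairs of arrows out of \<open>T\<close>, and \<open>local_closure\<close> is
  its closure for the topology whose covers are the single regular epimorphisms.\<close>

definition stable :: "('o, 'a, 'c) cat_scheme \<Rightarrow> 'a rel \<Rightarrow> bool" where
  "stable C P \<longleftrightarrow> (\<forall>(x, y) \<in> P. x \<in> Arr C \<and> y \<in> Arr C \<and> Dom C x = Dom C y \<and>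
     (\<forall>u \<in> Arr C. Cod C u = Dom C x \<longrightarrow> (Comp C x u, Comp C y u) \<in> P))"

definition local_closure :: "('o, 'a, 'c) cat_scheme \<Rightarrow> 'a rel \<Rightarrow> 'a rel" where
  "local_closure C P = {(x, y). x \<in> Arr C \<and> y \<in> Arr C \<and> Dom C x = Dom C y \<and>
     (\<exists>e. regular_epi C e \<and> Cod C e = Dom C x \<and> (Comp C x e, Comp C y e) \<in> P)}"

lemma stableD:
  assumes "stable C P" "(x, y) \<in> P"
  shows "x \<in> Arr C" "y \<in> Arr C" "Dom C y = Dom C x"
    "u \<in> Arr C \<Longrightarrow> Cod C u = Dom C x \<Longrightarrow> (Comp C x u, Comp C y u) \<in> P"
  using assms by (auto simp: stable_def)

lemma stable_relcomp: "stable C P \<Longrightarrow> stable C Q \<Longrightarrow> stable C (P O Q)"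
  unfolding stable_def by fastforce

lemma stable_converse: "stable C P \<Longrightarrow> stable C (P\<inverse>)"
  unfolding stable_def by fastforce

lemma local_closureI:
  assumes "x \<in> Arr C" "y \<in> Arr C" "Dom C x = Dom C y"
    "regular_epi C e" "Cod C e = Dom C x" "(Comp C x e, Comp C y e) \<in> P"
  shows "(x, y) \<in> local_closure C P"
  using assms by (auto simp: local_closure_def)

lemma local_closureE:
  assumes "(x, y) \<in> local_closure C P"
  obtains e where "x \<in> Arr C" "y \<in> Arr C" "Dom C y = Dom C x"
    "regular_epi C e" "Cod C e = Dom C x" "(Comp C x e, Comp C y e) \<in> P"
  using assms unfolding local_closure_def by auto

lemma local_closure_mono: "P \<subseteq> Q \<Longrightarrow> local_closure C P \<subseteq> local_closure C Q"
  by (auto simp: local_closure_def)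

lemma local_closure_converse: "(local_closure C P)\<inverse> = local_closure C (P\<inverse>)"
  by (auto simp: local_closure_def)

context regular_category begin

lemma local_closure_increasing:
  assumes "stable C P"
  shows "P \<subseteq> local_closure C P"
proof clarify
  fix x y assume xy: "(x, y) \<in> P"
  note st = stableD[OF assms xy]
  show "(x, y) \<in> local_closure C P"
  proof (rule local_closureI)
    show "regular_epi C (Ident C (Dom C x))" using Ident_regular_epi st(1) by simp
    show "(x \<cdot> Ident C (Dom C x), y \<cdot> Ident C (Dom C x)) \<in> P"
      using xy st Comp_Ident_Arr(1)[OF st(1)] Comp_Ident_Arr(1)[OF st(2)] by simp
  qed (use st in simp_all)
qed

lemma stable_local_closure:
  assumes "stable C P"
  shows "stable C (local_closure C P)"
proof -
  have "(x \<cdot> u, y \<cdot> u) \<in> local_closure C P"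
    if xy: "(x, y) \<in> local_closure C P" and u: "u \<in> Arr C" "Cod C u = Dom C x" for x y u
  proof -
    obtain e where e: "x \<in> Arr C" "y \<in> Arr C" "Dom C y = Dom C x" "regular_epi C e"
      "Cod C e = Dom C x" "(x \<cdot> e, y \<cdot> e) \<in> P"
      using local_closureE[OF xy] .
    have eA: "e \<in> Arr C" using e regular_epi_Arr by simp
    obtain e' v where v: "regular_epi C e'" "e' \<in> Arr C" "Cod C e' = Dom C u" "v \<in> Arr C"
      "Cod C v = Dom C e" "Dom C v = Dom C e'" "u \<cdot> e' = e \<cdot> v"
      using cover_pullback[OF e(4) u(1)] u e by metis
    have "((x \<cdot> e) \<cdot> v, (y \<cdot> e) \<cdot> v) \<in> P"
      using stableD(4)[OF assms e(6) v(4)] v e eA by simp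
    then have "((x \<cdot> u) \<cdot> e', (y \<cdot> u) \<cdot> e') \<in> P"
      using e v u eA by simp
    then show ?thesis using e v u by (intro local_closureI[of _ _ _ e']) simp_all
  qed
  then show ?thesis unfolding stable_def by (auto elim: local_closureE)
qed

lemma local_closure_idem: "local_closure C (local_closure C P) \<subseteq> local_closure C P"
proof clarify
  fix x y assume "(x, y) \<in> local_closure C (local_closure C P)"
  then obtain e where e: "x \<in> Arr C" "y \<in> Arr C" "Dom C y = Dom C x" "regular_epi C e"
      "Cod C e = Dom C x" "(x \<cdot> e, y \<cdot> e) \<in> local_closure C P" by (rule local_closureE)
  from e(6) obtain e' where e': "regular_epi C e'" "Cod C e' = Dom C (x \<cdot> e)"
    "((x \<cdot> e) \<cdot> e', (y \<cdot> e) \<cdot> e') \<in> P" by (rule local_closureE)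
  have A: "e \<in> Arr C" "e' \<in> Arr C" using e e' regular_epi_Arr by auto
  have c: "Cod C e' = Dom C e" using e e' A by simp
  show "(x, y) \<in> local_closure C P"
  proof (rule local_closureI)
    show "regular_epi C (e \<cdot> e')" using regular_epi_Comp e e' c by blast
    show "(x \<cdot> (e \<cdot> e'), y \<cdot> (e \<cdot> e')) \<in> P" using e'(3) e A c by simp
  qed (use e A c in simp_all)
qed

lemma local_closure_least: "P \<subseteq> local_closure C Q \<Longrightarrow> local_closure C P \<subseteq> local_closure C Q"
  using local_closure_mono local_closure_idem by blast

text \<open>The two membership proofs live on different covers \<open>e\<close> and \<open>d\<close> of the same domain; the
  composite \<open>d \<cdot> e'\<close> with a pullback \<open>e'\<close> of \<open>e\<close> refines both, and stability moves both proofs to it.\<close>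

lemma local_closure_relcomp_subset:
  assumes P: "stable C P" and Q: "stable C Q"
  shows "local_closure C P O local_closure C Q \<subseteq> local_closure C (P O Q)"
proof clarify
  fix x y z assume xy: "(x, y) \<in> local_closure C P" and yz: "(y, z) \<in> local_closure C Q"
  obtain e where e: "x \<in> Arr C" "y \<in> Arr C" "Dom C y = Dom C x" "regular_epi C e"
    "Cod C e = Dom C x" "(x \<cdot> e, y \<cdot> e) \<in> P" using local_closureE[OF xy] .
  obtain d where d: "z \<in> Arr C" "Dom C z = Dom C y" "regular_epi C d"
    "Cod C d = Dom C y" "(y \<cdot> d, z \<cdot> d) \<in> Q" using local_closureE[OF yz] .
  have A: "e \<in> Arr C" "d \<in> Arr C" using e d regular_epi_Arr by auto
  obtain e' v where v: "regular_epi C e'" "e' \<in> Arr C" "Cod C e' = Dom C d" "v \<in> Arr C"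
    "Cod C v = Dom C e" "Dom C v = Dom C e'" "d \<cdot> e' = e \<cdot> v"
    using cover_pullback[OF e(4) A(2)] d e by metis
  have "((x \<cdot> e) \<cdot> v, (y \<cdot> e) \<cdot> v) \<in> P" using stableD(4)[OF P e(6) v(4)] v e A by simp
  then have 1: "(x \<cdot> (d \<cdot> e'), y \<cdot> (d \<cdot> e')) \<in> P" using e v A by simp
  have "((y \<cdot> d) \<cdot> e', (z \<cdot> d) \<cdot> e') \<in> Q" using stableD(4)[OF Q d(5) v(2)] v e d A by simp
  then have 2: "(y \<cdot> (d \<cdot> e'), z \<cdot> (d \<cdot> e')) \<in> Q" using e v A d by simp
  show "(x, z) \<in> local_closure C (P O Q)"
  proof (rule local_closureI)
    show "regular_epi C (d \<cdot> e')" using regular_epi_Comp d v by blast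
    show "(x \<cdot> (d \<cdot> e'), z \<cdot> (d \<cdot> e')) \<in> P O Q" using 1 2 by blast
  qed (use e d v A in simp_all)
qed

lemma local_closure_relcomp:
  assumes P: "stable C P" and Q: "stable C Q"
  shows "local_closure C (local_closure C P O local_closure C Q) = local_closure C (P O Q)"
proof
  show "local_closure C (local_closure C P O local_closure C Q) \<subseteq> local_closure C (P O Q)"
    using local_closure_least local_closure_relcomp_subset[OF P Q] .
  show "local_closure C (P O Q) \<subseteq> local_closure C (local_closure C P O local_closure C Q)"
    using local_closure_mono[of "P O Q"] local_closure_increasing[OF P] local_closure_increasing[OF Q]
    by blast
qed
end

section \<open>Generalized elements of relations\<close>

definition arrows_into :: "('o, 'a, 'c) cat_scheme \<Rightarrow> 'o \<Rightarrow> 'a set" where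
  "arrows_into C X = {x \<in> Arr C. Cod C x = X}"

definition points :: "('o, 'a, 'c) cat_scheme \<Rightarrow> 'o \<Rightarrow> 'a \<Rightarrow> 'a rel" where
  "points C X t = {(Comp C (leg1 C X t) h, Comp C (leg2 C X t) h) | h. h \<in> arrows_into C (Dom C t)}"

definition pairs :: "('o, 'a, 'c) cat_scheme \<Rightarrow> 'o \<Rightarrow> 'a set \<Rightarrow> 'a rel" where
  "pairs C X R = (\<Union>r \<in> R. points C X r)"

text \<open>Inverse to \<open>pairs\<close> wherever it is nonempty. Nonemptiness says that \<open>P\<close> is representable.\<close>

definition relation_of :: "('o, 'a, 'c) cat_scheme \<Rightarrow> 'o \<Rightarrow> 'a rel \<Rightarrow> 'a set" where
  "relation_of C X P = {t. monic C t \<and> Cod C t = Prod C X X \<and> points C X t = P}"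

context regular_category begin

lemma pr_Arr [simp]:
  assumes "X \<in> Obj C"
  shows "pr1 C X X \<in> Arr C" "pr2 C X X \<in> Arr C" "Dom C (pr1 C X X) = Prod C X X"
    "Dom C (pr2 C X X) = Prod C X X" "Cod C (pr1 C X X) = X" "Cod C (pr2 C X X) = X"
  using pr_hom[OF assms assms] by (auto simp: hom_def)

lemma leg_Arr [simp]:
  assumes "X \<in> Obj C" "t \<in> Arr C" "Cod C t = Prod C X X"
  shows "leg1 C X t \<in> Arr C" "leg2 C X t \<in> Arr C" "Dom C (leg1 C X t) = Dom C t"
    "Dom C (leg2 C X t) = Dom C t" "Cod C (leg1 C X t) = X" "Cod C (leg2 C X t) = X"
  using assms by (auto simp: leg1_def leg2_def)

lemma leg_Comp:
  assumes "X \<in> Obj C" "t \<in> Arr C" "Cod C t = Prod C X X" "h \<in> Arr C" "Cod C h = Dom C t"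
  shows "leg1 C X (t \<cdot> h) = leg1 C X t \<cdot> h" "leg2 C X (t \<cdot> h) = leg2 C X t \<cdot> h"
  using assms by (auto simp: leg1_def leg2_def)

lemma leg_ext:
  assumes "X \<in> Obj C" "s \<in> Arr C" "t \<in> Arr C" "Cod C s = Prod C X X" "Cod C t = Prod C X X"
    "Dom C s = Dom C t" "leg1 C X s = leg1 C X t" "leg2 C X s = leg2 C X t"
  shows "s = t"
  using product_ext[of X X s "Dom C s" t] assms by (auto simp: leg1_def leg2_def hom_def)

lemma tuple_Arr [simp]:
  assumes "a \<in> Arr C" "b \<in> Arr C" "Dom C a = Dom C b" "Cod C a = X" "Cod C b = X"
  shows "tuple C a b \<in> Arr C" "Dom C (tuple C a b) = Dom C b" "Cod C (tuple C a b) = Prod C X X"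
    "leg1 C X (tuple C a b) = a" "leg2 C X (tuple C a b) = b"
  using tuple_props[of a "Dom C b" X b X] assms by (auto simp: leg1_def leg2_def hom_def)

lemma pointsI:
  assumes "h \<in> Arr C" "Cod C h = Dom C t"
  shows "(leg1 C X t \<cdot> h, leg2 C X t \<cdot> h) \<in> points C X t"
  using assms by (auto simp: points_def arrows_into_def)

lemma pointsE:
  assumes "(x, y) \<in> points C X t"
  obtains h where "h \<in> Arr C" "Cod C h = Dom C t" "x = leg1 C X t \<cdot> h" "y = leg2 C X t \<cdot> h"
  using assms by (auto simp: points_def arrows_into_def)

lemma stable_points:
  assumes "X \<in> Obj C" "t \<in> Arr C" "Cod C t = Prod C X X"
  shows "stable C (points C X t)"
proof -
  have "((leg1 C X t \<cdot> h) \<cdot> u, (leg2 C X t \<cdot> h) \<cdot> u) \<in> points C X t"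
    if "h \<in> Arr C" "Cod C h = Dom C t" "u \<in> Arr C" "Cod C u = Dom C h" for h u
    using pointsI[of "h \<cdot> u" t X] assms that by simp
  then show ?thesis unfolding stable_def using assms
    by (auto elim!: pointsE)
qed

lemma legs_in_points:
  assumes "X \<in> Obj C" "t \<in> Arr C" "Cod C t = Prod C X X"
  shows "(leg1 C X t, leg2 C X t) \<in> points C X t"
  using pointsI[of "Ident C (Dom C t)" t X] assms Comp_Ident_Arr(1)[of "leg1 C X t"]
    Comp_Ident_Arr(1)[of "leg2 C X t"] by simp

text \<open>The pair of legs of \<open>s\<close> is the universal point of \<open>s\<close>; its membership in the points of \<open>t\<close> is
  the required factorization.\<close>

lemma points_subset_iff_factor:
  assumes X: "X \<in> Obj C" and s: "s \<in> Arr C" "Cod C s = Prod C X X"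
    and t: "t \<in> Arr C" "Cod C t = Prod C X X"
  shows "points C X s \<subseteq> points C X t \<longleftrightarrow> (\<exists>k \<in> hom C (Dom C s) (Dom C t). t \<cdot> k = s)"
proof
  assume "points C X s \<subseteq> points C X t"
  then have "(leg1 C X s, leg2 C X s) \<in> points C X t" using legs_in_points[OF X s] by blast
  then obtain k where k: "k \<in> Arr C" "Cod C k = Dom C t" "leg1 C X s = leg1 C X t \<cdot> k"
    "leg2 C X s = leg2 C X t \<cdot> k" by (rule pointsE)
  have "Dom C k = Dom C s" using arg_cong[OF k(3), of "Dom C"] k(1,2) X s t by simp
  moreover have "t \<cdot> k = s"
    by (rule leg_ext[OF X]) (use k calculation s t X in \<open>simp_all add: leg_Comp\<close>)
  ultimately show "\<exists>k \<in> hom C (Dom C s) (Dom C t). t \<cdot> k = s" using k by (auto simp: hom_def)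
next
  assume "\<exists>k \<in> hom C (Dom C s) (Dom C t). t \<cdot> k = s"
  then obtain k where k: "k \<in> Arr C" "Dom C k = Dom C s" "Cod C k = Dom C t" "t \<cdot> k = s"
    by (auto simp: hom_def)
  have "leg1 C X s = leg1 C X t \<cdot> k" "leg2 C X s = leg2 C X t \<cdot> k"
    using leg_Comp[OF X t k(1,3)] k(4) by simp_all
  then show "points C X s \<subseteq> points C X t"
    using k X s t pointsI[of "k \<cdot> _" t X] by (auto elim!: pointsE)
qed

text \<open>A local factorization through a monomorphism glues to a global one by orthogonality.\<close>

lemma points_monic_local:
  assumes X: "X \<in> Obj C" and t: "monic C t" "Cod C t = Prod C X X"
  shows "local_closure C (points C X t) = points C X t"
proof
  have tA: "t \<in> Arr C" using t by (simp add: monic_def)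
  show "points C X t \<subseteq> local_closure C (points C X t)"
    by (rule local_closure_increasing[OF stable_points[OF X tA t(2)]])
  show "local_closure C (points C X t) \<subseteq> points C X t"
  proof clarify
    fix x y assume "(x, y) \<in> local_closure C (points C X t)"
    then obtain e where e: "x \<in> Arr C" "y \<in> Arr C" "Dom C y = Dom C x" "regular_epi C e"
      "Cod C e = Dom C x" "(x \<cdot> e, y \<cdot> e) \<in> points C X t" by (rule local_closureE)
    have eA: "e \<in> Arr C" using e regular_epi_Arr by simp
    obtain h where h: "h \<in> Arr C" "Cod C h = Dom C t" "x \<cdot> e = leg1 C X t \<cdot> h"
      "y \<cdot> e = leg2 C X t \<cdot> h" using pointsE[OF e(6)] .
    have d: "Dom C h = Dom C e" using arg_cong[OF h(3), of "Dom C"] h(1,2) e(1,5) eA X t tA by simp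
    have c: "Cod C x = X" "Cod C y = X"
      using arg_cong[OF h(3), of "Cod C"] arg_cong[OF h(4), of "Cod C"] h(1,2) e(1-5) eA X t tA by simp_all
    note xy = e(1,2) e(3)[symmetric] c
    have sq: "t \<cdot> h = tuple C x y \<cdot> e"
      by (rule leg_ext[OF X]) (use xy h(1,2) h(3,4)[symmetric] e(5) eA d X t tA in \<open>simp_all add: leg_Comp\<close>)
    obtain w where w: "w \<in> Arr C" "Cod C w = Dom C t" "t \<cdot> w = tuple C x y"
      by (rule regular_epi_lift[OF e(4) t(1) h(1) d h(2) _ _ _ sq]) (use xy e(5) t(2) in simp_all)
    have "x = leg1 C X t \<cdot> w" "y = leg2 C X t \<cdot> w"
      using leg_Comp[OF X tA t(2) w(1,2)] w(3) xy by simp_all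
    then show "(x, y) \<in> points C X t" using pointsI w by simp
  qed
qed

text \<open>A point of \<open>i\<close> lifts along the cover \<open>e\<close> once its domain is replaced by the pulled back
  cover.\<close>

lemma points_Comp_cover:
  assumes X: "X \<in> Obj C" and i: "monic C i" "Cod C i = Prod C X X"
    and e: "regular_epi C e" "Cod C e = Dom C i"
  shows "points C X i = local_closure C (points C X (i \<cdot> e))"
proof
  have A: "i \<in> Arr C" "e \<in> Arr C" using i e regular_epi_Arr by (auto simp: monic_def)
  show "local_closure C (points C X (i \<cdot> e)) \<subseteq> points C X i"
    using points_subset_iff_factor[of X "i \<cdot> e" i] X A i e
      local_closure_mono[of "points C X (i \<cdot> e)" "points C X i" C] points_monic_local[OF X i]
    by (auto simp: hom_def)
  show "points C X i \<subseteq> local_closure C (points C X (i \<cdot> e))"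
  proof clarify
    fix x y assume "(x, y) \<in> points C X i"
    then obtain h where h: "h \<in> Arr C" "Cod C h = Dom C i" "x = leg1 C X i \<cdot> h"
      "y = leg2 C X i \<cdot> h" by (rule pointsE)
    obtain e' v where v: "regular_epi C e'" "e' \<in> Arr C" "Cod C e' = Dom C h" "v \<in> Arr C"
      "Cod C v = Dom C e" "Dom C v = Dom C e'" "h \<cdot> e' = e \<cdot> v"
      using cover_pullback[OF e(1) h(1)] h e by metis
    have "(x \<cdot> e', y \<cdot> e') = (leg1 C X (i \<cdot> e) \<cdot> v, leg2 C X (i \<cdot> e) \<cdot> v)"
      using h v X i A e by (simp add: leg_Comp)
    then have "(x \<cdot> e', y \<cdot> e') \<in> points C X (i \<cdot> e)"
      using pointsI[of v "i \<cdot> e" X] v A e by simp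
    then show "(x, y) \<in> local_closure C (points C X (i \<cdot> e))"
      by (intro local_closureI[of _ _ _ e']) (use h v X i A in simp_all)
  qed
qed

lemma same_points_iso:
  assumes X: "X \<in> Obj C" and s: "monic C s" "Cod C s = Prod C X X"
    and t: "monic C t" "Cod C t = Prod C X X" and eq: "points C X s = points C X t"
  obtains i j where "i \<in> hom C (Dom C s) (Dom C t)" "j \<in> hom C (Dom C t) (Dom C s)"
    "t \<cdot> i = s" "s \<cdot> j = t" "j \<cdot> i = Ident C (Dom C s)" "i \<cdot> j = Ident C (Dom C t)"
proof -
  have A: "s \<in> Arr C" "t \<in> Arr C" using s t by (auto simp: monic_def)
  obtain i where i: "i \<in> hom C (Dom C s) (Dom C t)" "t \<cdot> i = s"
    using points_subset_iff_factor[OF X A(1) s(2) A(2) t(2)] eq by blast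
  obtain j where j: "j \<in> hom C (Dom C t) (Dom C s)" "s \<cdot> j = t"
    using points_subset_iff_factor[OF X A(2) t(2) A(1) s(2)] eq by blast
  have ij: "i \<in> Arr C" "j \<in> Arr C" "Dom C i = Dom C s" "Cod C i = Dom C t" "Dom C j = Dom C t"
    "Cod C j = Dom C s" using i j by (auto simp: hom_def)
  have "s \<cdot> (j \<cdot> i) = (s \<cdot> j) \<cdot> i" using ij A by simp
  also have "\<dots> = s \<cdot> Ident C (Dom C s)" using i(2) j(2) A by simp
  finally have 1: "j \<cdot> i = Ident C (Dom C s)"
    by (rule monicD[OF s(1), rotated -1]) (use ij A in simp_all)
  have "t \<cdot> (i \<cdot> j) = (t \<cdot> i) \<cdot> j" using ij A by simp
  also have "\<dots> = t \<cdot> Ident C (Dom C t)" using i(2) j(2) A by simp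
  finally have 2: "i \<cdot> j = Ident C (Dom C t)"
    by (rule monicD[OF t(1), rotated -1]) (use ij A in simp_all)
  show thesis using that i j 1 2 by blast
qed

lemma sub_class_eq_relation_of:
  assumes X: "X \<in> Obj C" and r: "monic C r" "Cod C r = Prod C X X"
  shows "sub_class C r = relation_of C X (points C X r)"
proof
  have rA: "r \<in> Arr C" using r by (simp add: monic_def)
  show "sub_class C r \<subseteq> relation_of C X (points C X r)"
  proof
    fix s assume "s \<in> sub_class C r"
    then obtain i where s: "monic C s" "Cod C s = Cod C r" and i: "i \<in> hom C (Dom C s) (Dom C r)"
      "iso_arr C i" "r \<cdot> i = s" by (auto simp: sub_class_def)
    obtain j where j: "j \<in> hom C (Dom C r) (Dom C s)" "i \<cdot> j = Ident C (Dom C r)"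
      using i by (auto simp: iso_arr_def hom_def)
    have sA: "s \<in> Arr C" using s by (simp add: monic_def)
    have "s \<cdot> j = (r \<cdot> i) \<cdot> j" by (simp only: i(3))
    also have "\<dots> = r \<cdot> (i \<cdot> j)"
      using i(1) j(1) rA by (intro Comp_assoc_Arr) (simp_all add: hom_def)
    also have "\<dots> = r" using j rA by simp
    finally have "s \<cdot> j = r" .
    then have "points C X r = points C X s"
      using points_subset_iff_factor[of X r s] points_subset_iff_factor[of X s r] X r s sA rA i j by auto
    then show "s \<in> relation_of C X (points C X r)" using s r by (simp add: relation_of_def)
  qed
  show "relation_of C X (points C X r) \<subseteq> sub_class C r"
  proof
    fix s assume "s \<in> relation_of C X (points C X r)"
    then have s: "monic C s" "Cod C s = Prod C X X" "points C X s = points C X r"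
      by (auto simp: relation_of_def)
    obtain i j where ij: "i \<in> hom C (Dom C s) (Dom C r)" "j \<in> hom C (Dom C r) (Dom C s)"
      "r \<cdot> i = s" "s \<cdot> j = r" "j \<cdot> i = Ident C (Dom C s)" "i \<cdot> j = Ident C (Dom C r)"
      using same_points_iso[OF X s(1,2) r s(3)] .
    then have "iso_arr C i" by (auto simp: iso_arr_def hom_def)
    then show "s \<in> sub_class C r" using s r ij by (auto simp: sub_class_def)
  qed
qed

text \<open>All the monomorphisms with the same points as the image are isomorphic to it, and composing the
  regular epimorphic part with such an isomorphism shows that they too are images.\<close>

lemma arrow_image_eq_relation_of:
  assumes X: "X \<in> Obj C" and t: "t \<in> Arr C" "Cod C t = Prod C X X"
  shows "arrow_image C t = relation_of C X (local_closure C (points C X t))"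
    "arrow_image C t \<noteq> {}"
proof -
  obtain q j where f: "regular_epi C q" "monic C j" "j \<cdot> q = t" "Dom C q = Dom C t"
    "Cod C q = Dom C j" "Cod C j = Cod C t"
    using ex_factorization_Arr[OF t(1)] .
  have fA: "q \<in> Arr C" "j \<in> Arr C" using f regular_epi_Arr by (auto simp: monic_def)
  have "q \<in> hom C (Dom C t) (Dom C j)" using f fA by (simp add: hom_def)
  then show "arrow_image C t \<noteq> {}" using f unfolding arrow_image_def by blast
  have pj: "points C X j = local_closure C (points C X t)"
    using points_Comp_cover[OF X f(2) _ f(1,5)] f t by simp
  show "arrow_image C t = relation_of C X (local_closure C (points C X t))"
  proof (intro equalityI subsetI)
    fix i assume "i \<in> arrow_image C t"
    then obtain e where i: "monic C i" "Cod C i = Cod C t" and e: "regular_epi C e"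
      "e \<in> hom C (Dom C t) (Dom C i)" "i \<cdot> e = t" unfolding arrow_image_def by blast
    then show "i \<in> relation_of C X (local_closure C (points C X t))"
      using points_Comp_cover[OF X i(1) _ e(1)] t by (simp add: relation_of_def hom_def)
  next
    fix i assume "i \<in> relation_of C X (local_closure C (points C X t))"
    then have i: "monic C i" "Cod C i = Prod C X X" "points C X i = points C X j"
      using pj by (auto simp: relation_of_def)
    have jc: "Cod C j = Prod C X X" using f t by simp
    have iA: "i \<in> Arr C" using i by (simp add: monic_def)
    obtain k l where kl: "k \<in> hom C (Dom C i) (Dom C j)" "l \<in> hom C (Dom C j) (Dom C i)"
      "i \<cdot> l = j" "l \<cdot> k = Ident C (Dom C i)" "k \<cdot> l = Ident C (Dom C j)"
      using same_points_iso[OF X i(1,2) f(2) jc i(3)] .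
    have kl': "k \<in> Arr C" "l \<in> Arr C" "Dom C k = Dom C i" "Cod C k = Dom C j" "Dom C l = Dom C j"
      "Cod C l = Dom C i" using kl by (auto simp: hom_def)
    have "regular_epi C (l \<cdot> q)"
      by (rule regular_epi_Comp_iso[OF f(1) kl'(2) _ kl'(1)])
        (simp_all only: kl(4,5) kl'(3-6) f(5))
    moreover have "i \<cdot> (l \<cdot> q) = (i \<cdot> l) \<cdot> q"
      using kl' fA f iA by (intro Comp_assoc_Arr[symmetric]) simp_all
    moreover have "l \<cdot> q \<in> hom C (Dom C t) (Dom C i)" using kl' fA f by (simp add: hom_def)
    ultimately show "i \<in> arrow_image C t"
      using i t kl f unfolding arrow_image_def by auto
  qed
qed

end

section \<open>Operations on relations in terms of generalized elements\<close>

definition graph :: "('o, 'a, 'c) cat_scheme \<Rightarrow> 'a \<Rightarrow> 'a rel" where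
  "graph C f = {(x, Comp C f x) | x. x \<in> arrows_into C (Dom C f)}"

context regular_category begin

lemma relation_onD:
  assumes R: "relation_on C X R"
  shows "X \<in> Obj C" "R = relation_of C X (pairs C X R)" "R \<noteq> {}"
    "r \<in> R \<Longrightarrow> points C X r = pairs C X R" "r \<in> R \<Longrightarrow> monic C r" "r \<in> R \<Longrightarrow> r \<in> Arr C"
    "r \<in> R \<Longrightarrow> Cod C r = Prod C X X"
proof -
  obtain r0 where r0: "monic C r0" "Cod C r0 = Prod C X X" "R = sub_class C r0" and X: "X \<in> Obj C"
    using R by (auto simp: relation_on_def subobject_def)
  have eq: "R = relation_of C X (points C X r0)" using r0 sub_class_eq_relation_of[OF X] by simp
  have "pairs C X R = points C X r0"
    using r0 eq by (auto simp: pairs_def relation_of_def)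
  then show "X \<in> Obj C" "R = relation_of C X (pairs C X R)" "R \<noteq> {}"
    "r \<in> R \<Longrightarrow> points C X r = pairs C X R" "r \<in> R \<Longrightarrow> monic C r" "r \<in> R \<Longrightarrow> r \<in> Arr C"
    "r \<in> R \<Longrightarrow> Cod C r = Prod C X X"
    using X eq r0 by (auto simp: relation_of_def monic_def)
qed

lemma relation_of_relation:
  assumes X: "X \<in> Obj C" and ne: "relation_of C X P \<noteq> {}"
  shows "relation_on C X (relation_of C X P)" "pairs C X (relation_of C X P) = P"
proof -
  obtain t where t: "monic C t" "Cod C t = Prod C X X" "points C X t = P"
    using ne by (auto simp: relation_of_def)
  have "relation_of C X P = sub_class C t" using sub_class_eq_relation_of[OF X t(1,2)] t(3) by simp
  then show "relation_on C X (relation_of C X P)"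
    using X t by (auto simp: relation_on_def subobject_def)
  show "pairs C X (relation_of C X P) = P" using t by (auto simp: pairs_def relation_of_def)
qed

lemma relation_eq_iff:
  assumes "relation_on C X R" "relation_on C X S"
  shows "R = S \<longleftrightarrow> pairs C X R = pairs C X S"
  using relation_onD(2)[OF assms(1)] relation_onD(2)[OF assms(2)] by metis

lemma sub_le_iff:
  assumes R: "relation_on C X R" and S: "relation_on C X S"
  shows "sub_le C R S \<longleftrightarrow> pairs C X R \<subseteq> pairs C X S"
proof -
  have *: "(\<exists>h \<in> hom C (Dom C r) (Dom C s). s \<cdot> h = r) \<longleftrightarrow> pairs C X R \<subseteq> pairs C X S"
    if "r \<in> R" "s \<in> S" for r s
    using points_subset_iff_factor[of X r s] relation_onD(1,4,6,7)[OF R] relation_onD(1,4,6,7)[OF S] that by simp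
  show ?thesis
    using * relation_onD(3)[OF R] relation_onD(3)[OF S] unfolding sub_le_def by blast
qed

lemma stable_pairs:
  assumes "relation_on C X R"
  shows "stable C (pairs C X R)"
  using relation_onD(1,3,4,6,7)[OF assms] stable_points[of X] by (metis ex_in_conv)

lemma pairs_local:
  assumes "relation_on C X R"
  shows "local_closure C (pairs C X R) = pairs C X R"
  using relation_onD(1,3-5,7)[OF assms] points_monic_local[of X] by (metis ex_in_conv)

lemma pairs_arrows_into:
  assumes "relation_on C X R"
  shows "pairs C X R \<subseteq> arrows_into C X \<times> arrows_into C X"
  using relation_onD(1,6,7)[OF assms] by (auto simp: pairs_def points_def arrows_into_def)

lemma monicI_legs:
  assumes X: "X \<in> Obj C" and t: "t \<in> Arr C" "Cod C t = Prod C X X"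
    and inj: "\<And>u v. u \<in> Arr C \<Longrightarrow> v \<in> Arr C \<Longrightarrow> Dom C u = Dom C v \<Longrightarrow> Cod C u = Dom C t \<Longrightarrow>
      Cod C v = Dom C t \<Longrightarrow> leg1 C X t \<cdot> u = leg1 C X t \<cdot> v \<Longrightarrow> leg2 C X t \<cdot> u = leg2 C X t \<cdot> v \<Longrightarrow> u = v"
  shows "monic C t"
  unfolding monic_def
proof (intro conjI allI ballI impI)
  fix T u v assume "u \<in> hom C T (Dom C t)" "v \<in> hom C T (Dom C t)" and eq: "t \<cdot> u = t \<cdot> v"
  then have uv: "u \<in> Arr C" "v \<in> Arr C" "Dom C u = Dom C v" "Cod C u = Dom C t" "Cod C v = Dom C t"
    by (auto simp: hom_def)
  show "u = v"
    by (rule inj[OF uv]) (use eq leg_Comp[OF X t uv(1,4)] leg_Comp[OF X t uv(2,5)] in simp_all)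
qed (rule t)

lemma diagonal_relation:
  assumes X: "X \<in> Obj C"
  shows "relation_on C X (diagonal C X)" "pairs C X (diagonal C X) = Id_on (arrows_into C X)"
proof -
  define d where "d = tuple C (Ident C X) (Ident C X)"
  have d: "d \<in> Arr C" "Dom C d = X" "Cod C d = Prod C X X" "leg1 C X d = Ident C X" "leg2 C X d = Ident C X"
    unfolding d_def using X by simp_all
  have m: "monic C d"
    by (rule monicI_legs[OF X d(1,3)]) (metis Comp_Ident_Arr(2) d(2,4))
  have p: "points C X d = Id_on (arrows_into C X)"
  proof -
    have "Ident C X \<cdot> h = h" if "h \<in> arrows_into C X" for h
      using that Comp_Ident_Arr(2)[of h] by (auto simp: arrows_into_def)
    then have "points C X d = {(h, h) | h. h \<in> arrows_into C X}"
      unfolding points_def d(2,4,5)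
      by (intro Collect_cong ex_cong1 rev_conj_cong[OF refl]) simp
    then show ?thesis by auto
  qed
  have *: "diagonal C X = relation_of C X (Id_on (arrows_into C X))"
    using sub_class_eq_relation_of[OF X m d(3)] p by (simp add: diagonal_def d_def)
  have ne: "relation_of C X (Id_on (arrows_into C X)) \<noteq> {}" using m d p by (auto simp: relation_of_def)
  show "relation_on C X (diagonal C X)" "pairs C X (diagonal C X) = Id_on (arrows_into C X)"
    unfolding * using relation_of_relation[OF X ne] by simp_all
qed

lemma opposite_relation:
  assumes R: "relation_on C X R"
  shows "relation_on C X (opposite C X R)" "pairs C X (opposite C X R) = (pairs C X R)\<inverse>"
proof -
  note X = relation_onD(1)[OF R]
  have *: "sub_class C (tuple C (leg2 C X r) (leg1 C X r)) = relation_of C X ((pairs C X R)\<inverse>)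
      \<and> relation_of C X ((pairs C X R)\<inverse>) \<noteq> {}" if r: "r \<in> R" for r
  proof -
    note r' = relation_onD(6,7)[OF R r]
    define t where "t = tuple C (leg2 C X r) (leg1 C X r)"
    have t: "t \<in> Arr C" "Dom C t = Dom C r" "Cod C t = Prod C X X" "leg1 C X t = leg2 C X r"
      "leg2 C X t = leg1 C X r"
      unfolding t_def using r' X by simp_all
    have m: "monic C t"
    proof (rule monicI_legs[OF X t(1,3)])
      fix u v assume uv: "u \<in> Arr C" "v \<in> Arr C" "Dom C u = Dom C v" "Cod C u = Dom C t"
        "Cod C v = Dom C t" "leg1 C X t \<cdot> u = leg1 C X t \<cdot> v" "leg2 C X t \<cdot> u = leg2 C X t \<cdot> v"
      have "r \<cdot> u = r \<cdot> v"
        by (rule leg_ext[OF X]) (use uv r' t X in \<open>simp_all add: leg_Comp\<close>)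
      then show "u = v" by (rule monicD[OF relation_onD(5)[OF R r], rotated -1]) (use uv t in simp_all)
    qed
    have p: "points C X t = (pairs C X R)\<inverse>"
      unfolding relation_onD(4)[OF R r, symmetric] points_def t(2,4,5) by auto
    show ?thesis using sub_class_eq_relation_of[OF X m t(3)] p m t by (auto simp: t_def relation_of_def)
  qed
  then have eq: "opposite C X R = relation_of C X ((pairs C X R)\<inverse>)"
    using relation_onD(3)[OF R] by (auto simp: opposite_def)
  have ne: "relation_of C X ((pairs C X R)\<inverse>) \<noteq> {}" using * relation_onD(3)[OF R] by blast
  show "relation_on C X (opposite C X R)" "pairs C X (opposite C X R) = (pairs C X R)\<inverse>"
    unfolding eq using relation_of_relation[OF X ne] by simp_all
qed

text \<open>By the universal property of the pullback, before any image is taken the elements of the span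
  composite compose exactly.\<close>

lemma points_span_composite:
  assumes X: "X \<in> Obj C" and r: "r \<in> Arr C" "Cod C r = Prod C X X" and s: "s \<in> Arr C" "Cod C s = Prod C X X"
    and pb: "pullback C (leg2 C X r) (leg1 C X s) a b"
  defines "t \<equiv> tuple C (leg1 C X r \<cdot> a) (leg2 C X s \<cdot> b)"
  shows "t \<in> Arr C" "Cod C t = Prod C X X" "points C X t = points C X r O points C X s"
proof -
  have L: "leg2 C X r \<in> Arr C" "leg1 C X s \<in> Arr C" "Cod C (leg2 C X r) = Cod C (leg1 C X s)"
    using X r s by simp_all
  note p = pullback_Arr[OF pb L]
  have ab: "a \<in> Arr C" "b \<in> Arr C" "Cod C a = Dom C r" "Cod C b = Dom C s" "Dom C b = Dom C a"
    using p(1-5) X r s by simp_all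
  show t: "t \<in> Arr C" "Cod C t = Prod C X X"
    unfolding t_def using ab X r s by simp_all
  have t': "Dom C t = Dom C a" "leg1 C X t = leg1 C X r \<cdot> a" "leg2 C X t = leg2 C X s \<cdot> b"
    unfolding t_def using ab X r s by simp_all
  show "points C X t = points C X r O points C X s"
  proof (intro equalityI subrelI)
    fix x z assume "(x, z) \<in> points C X t"
    then obtain h where h: "h \<in> Arr C" "Cod C h = Dom C a" "x = (leg1 C X r \<cdot> a) \<cdot> h"
      "z = (leg2 C X s \<cdot> b) \<cdot> h" by (rule pointsE) (simp_all add: t')
    have "(x, leg2 C X r \<cdot> (a \<cdot> h)) \<in> points C X r" 
      using pointsI[of "a \<cdot> h" r X] h ab X r by simp
    moreover have "(leg1 C X s \<cdot> (b \<cdot> h), z) \<in> points C X s"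
      using pointsI[of "b \<cdot> h" s X] h ab X s by simp
    moreover have "leg2 C X r \<cdot> (a \<cdot> h) = (leg2 C X r \<cdot> a) \<cdot> h" "leg1 C X s \<cdot> (b \<cdot> h) = (leg1 C X s \<cdot> b) \<cdot> h"
      using h ab X r s by simp_all
    ultimately show "(x, z) \<in> points C X r O points C X s" using p(6) by auto
  next
    fix x z assume "(x, z) \<in> points C X r O points C X s"
    then obtain y where xy: "(x, y) \<in> points C X r" and yz: "(y, z) \<in> points C X s" by blast
    obtain h where h: "h \<in> Arr C" "Cod C h = Dom C r" "x = leg1 C X r \<cdot> h" "y = leg2 C X r \<cdot> h"
      using pointsE[OF xy] .
    obtain k where k: "k \<in> Arr C" "Cod C k = Dom C s" "y = leg1 C X s \<cdot> k" "z = leg2 C X s \<cdot> k"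
      using pointsE[OF yz] .
    have "Dom C y = Dom C h" using h(1,2,4) X r by simp
    moreover have "Dom C y = Dom C k" using k(1-3) X s by simp
    ultimately have "Dom C h = Dom C k" by simp
    then obtain l where l: "l \<in> Arr C" "Cod C l = Dom C a" "a \<cdot> l = h" "b \<cdot> l = k"
      using p(7)[of h k] h k X r s by auto
    have "x = leg1 C X t \<cdot> l" "z = leg2 C X t \<cdot> l"
      unfolding t' h(3) k(4) using l ab X r s by (simp_all add: l(3,4)[symmetric] del: l(3,4))
    then show "(x, z) \<in> points C X t" using pointsI[of l t X] l t' by simp
  qed
qed

lemma rel_comp_relation:
  assumes R: "relation_on C X R" and S: "relation_on C X S"
  shows "relation_on C X (rel_comp C X S R)"
    "pairs C X (rel_comp C X S R) = local_closure C (pairs C X R O pairs C X S)"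
proof -
  note X = relation_onD(1)[OF R]
  have *: "arrow_image C (tuple C (leg1 C X r \<cdot> a) (leg2 C X s \<cdot> b))
        = relation_of C X (local_closure C (pairs C X R O pairs C X S))
      \<and> arrow_image C (tuple C (leg1 C X r \<cdot> a) (leg2 C X s \<cdot> b)) \<noteq> {}"
    if r: "r \<in> R" and s: "s \<in> S" and pb: "pullback C (leg2 C X r) (leg1 C X s) a b" for r s a b
    using points_span_composite[OF X relation_onD(6,7)[OF R r] relation_onD(6,7)[OF S s] pb]
      arrow_image_eq_relation_of[OF X, of "tuple C (leg1 C X r \<cdot> a) (leg2 C X s \<cdot> b)"]
      relation_onD(4)[OF R r] relation_onD(4)[OF S s] by simp
  obtain r s where rs: "r \<in> R" "s \<in> S" using relation_onD(3)[OF R] relation_onD(3)[OF S] by blast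
  obtain a b where ab: "pullback C (leg2 C X r) (leg1 C X s) a b"
    using ex_pullback_Arr[of "leg2 C X r" "leg1 C X s"] X relation_onD(6,7)[OF R rs(1)]
      relation_onD(6,7)[OF S rs(2)] by auto
  have eq: "rel_comp C X S R = relation_of C X (local_closure C (pairs C X R O pairs C X S))"
  proof (intro equalityI subsetI)
    show "t \<in> relation_of C X (local_closure C (pairs C X R O pairs C X S))" if "t \<in> rel_comp C X S R" for t
      using that * unfolding rel_comp_def by blast
    show "t \<in> rel_comp C X S R" if "t \<in> relation_of C X (local_closure C (pairs C X R O pairs C X S))" for t
      using that *[OF rs ab] rs ab unfolding rel_comp_def by blast
  qed
  have ne: "relation_of C X (local_closure C (pairs C X R O pairs C X S)) \<noteq> {}"
    using *[OF rs ab] by blast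
  show "relation_on C X (rel_comp C X S R)"
    "pairs C X (rel_comp C X S R) = local_closure C (pairs C X R O pairs C X S)"
    unfolding eq using relation_of_relation[OF X ne] by simp_all
qed

lemma equivalence_iff:
  assumes R: "relation_on C X R"
  shows "equivalence_on C X R \<longleftrightarrow> equiv (arrows_into C X) (pairs C X R)"
proof -
  note X = relation_onD(1)[OF R]
  have "sub_le C (diagonal C X) R \<longleftrightarrow> Id_on (arrows_into C X) \<subseteq> pairs C X R"
    using sub_le_iff[OF diagonal_relation(1)[OF X] R] diagonal_relation(2)[OF X] by simp
  also have "\<dots> \<longleftrightarrow> refl_on (arrows_into C X) (pairs C X R)"
    by (auto simp: refl_on_def)
  finally have 1: "sub_le C (diagonal C X) R \<longleftrightarrow> refl_on (arrows_into C X) (pairs C X R)" .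
  have 2: "sub_le C (opposite C X R) R \<longleftrightarrow> sym (pairs C X R)"
    using sub_le_iff[OF opposite_relation(1)[OF R] R] opposite_relation(2)[OF R] by (auto simp: sym_def)
  have "sub_le C (rel_comp C X R R) R \<longleftrightarrow> local_closure C (pairs C X R O pairs C X R) \<subseteq> pairs C X R"
    using sub_le_iff[OF rel_comp_relation(1)[OF R R] R] rel_comp_relation(2)[OF R R] by simp
  also have "\<dots> \<longleftrightarrow> pairs C X R O pairs C X R \<subseteq> pairs C X R"
    using local_closure_increasing[OF stable_relcomp[OF stable_pairs[OF R] stable_pairs[OF R]]]
      local_closure_mono[of "pairs C X R O pairs C X R" "pairs C X R" C] pairs_local[OF R] by auto
  also have "\<dots> \<longleftrightarrow> trans (pairs C X R)" by (auto simp: trans_def)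
  finally show ?thesis
    using 1 2 R pairs_arrows_into[OF R] by (auto simp: equivalence_on_def equiv_def)
qed

lemma legs_square_map:
  assumes f: "f \<in> hom C X Y" and r: "r \<in> Arr C" "Cod C r = Prod C X X"
  shows "square_map C f \<cdot> r \<in> Arr C" "Dom C (square_map C f \<cdot> r) = Dom C r"
    "Cod C (square_map C f \<cdot> r) = Prod C Y Y"
    "leg1 C Y (square_map C f \<cdot> r) = f \<cdot> leg1 C X r" "leg2 C Y (square_map C f \<cdot> r) = f \<cdot> leg2 C X r"
proof -
  have XY: "X \<in> Obj C" "Y \<in> Obj C" using homD[OF f] by auto
  note sf = square_map_props[OF f]
  have s: "square_map C f \<in> Arr C" "Dom C (square_map C f) = Prod C X X"
    "Cod C (square_map C f) = Prod C Y Y" using sf(1) by (auto simp: hom_def)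
  show "square_map C f \<cdot> r \<in> Arr C" "Dom C (square_map C f \<cdot> r) = Dom C r"
    "Cod C (square_map C f \<cdot> r) = Prod C Y Y" using s r by simp_all
  have "leg1 C Y (square_map C f \<cdot> r) = (pr1 C Y Y \<cdot> square_map C f) \<cdot> r"
    "leg2 C Y (square_map C f \<cdot> r) = (pr2 C Y Y \<cdot> square_map C f) \<cdot> r"
    using s r XY by (simp_all add: leg1_def leg2_def)
  then show "leg1 C Y (square_map C f \<cdot> r) = f \<cdot> leg1 C X r" "leg2 C Y (square_map C f \<cdot> r) = f \<cdot> leg2 C X r"
    using sf(2,3) f r XY by (simp_all add: leg1_def leg2_def hom_def)
qed

lemma points_square_map:
  assumes f: "f \<in> hom C X Y" and r: "r \<in> Arr C" "Cod C r = Prod C X X"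
  shows "points C Y (square_map C f \<cdot> r) = (graph C f)\<inverse> O points C X r O graph C f"
proof -
  have XY: "X \<in> Obj C" "Y \<in> Obj C" "f \<in> Arr C" "Dom C f = X" using homD[OF f] by auto
  have "points C Y (square_map C f \<cdot> r)
      = {(f \<cdot> (leg1 C X r \<cdot> h), f \<cdot> (leg2 C X r \<cdot> h)) | h. h \<in> arrows_into C (Dom C r)}"
    unfolding points_def legs_square_map[OF assms]
    by (rule Collect_cong, rule ex_cong1, rule rev_conj_cong[OF refl])
      (use XY r in \<open>simp add: arrows_into_def\<close>)
  also have "\<dots> = {(f \<cdot> x, f \<cdot> y) | x y. (x, y) \<in> points C X r}"
    by (auto simp: points_def)
  also have "\<dots> = (graph C f)\<inverse> O points C X r O graph C f"
  proof -
    have "x \<in> arrows_into C X \<and> y \<in> arrows_into C X" if "(x, y) \<in> points C X r" for x y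
      using that XY r by (auto simp: points_def arrows_into_def)
    then show ?thesis unfolding graph_def XY(4) relcomp_unfold by blast
  qed
  finally show ?thesis .
qed

lemma direct_image_relation:
  assumes f: "f \<in> hom C X Y" and R: "relation_on C X R"
  shows "relation_on C Y (direct_image C f R)"
    "pairs C Y (direct_image C f R) = local_closure C ((graph C f)\<inverse> O pairs C X R O graph C f)"
proof -
  let ?P = "local_closure C ((graph C f)\<inverse> O pairs C X R O graph C f)"
  have Y: "Y \<in> Obj C" using homD[OF f] by simp
  have *: "arrow_image C (square_map C f \<cdot> r) = relation_of C Y ?P
      \<and> arrow_image C (square_map C f \<cdot> r) \<noteq> {}" if r: "r \<in> R" for r
    using arrow_image_eq_relation_of[OF Y legs_square_map(1,3)[OF f relation_onD(6,7)[OF R r]]]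
      points_square_map[OF f relation_onD(6,7)[OF R r]] relation_onD(4)[OF R r] by simp
  have eq: "direct_image C f R = relation_of C Y ?P"
    using * relation_onD(3)[OF R] by (auto simp: direct_image_def)
  have ne: "relation_of C Y ?P \<noteq> {}" using * relation_onD(3)[OF R] by blast
  show "relation_on C Y (direct_image C f R)" "pairs C Y (direct_image C f R) = ?P"
    unfolding eq using relation_of_relation[OF Y ne] by simp_all
qed

text \<open>The pullback of a monomorphism along \<open>f \<times> f\<close> represents the set of pairs that \<open>f\<close> sends
  into \<open>S\<close>.\<close>

lemma ex_inverse_relation:
  assumes f: "f \<in> hom C A X" and S: "relation_on C X S"
  obtains T where "relation_on C A T"
    "pairs C A T = {(a, b). a \<in> arrows_into C A \<and> b \<in> arrows_into C A \<and> Dom C a = Dom C b \<and>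
       (f \<cdot> a, f \<cdot> b) \<in> pairs C X S}"
proof -
  have O: "A \<in> Obj C" "X \<in> Obj C" "f \<in> Arr C" "Dom C f = A" "Cod C f = X" using homD[OF f] by auto
  note sf = square_map_props(1)[OF f]
  have q: "square_map C f \<in> Arr C" "Dom C (square_map C f) = Prod C A A"
    "Cod C (square_map C f) = Prod C X X" using sf by (auto simp: hom_def)
  obtain s where s: "s \<in> S" using relation_onD(3)[OF S] by blast
  note s' = relation_onD(4-7)[OF S s]
  have c: "Cod C (square_map C f) = Cod C s" using q s' by simp
  obtain t k where pb: "pullback C (square_map C f) s t k"
    using ex_pullback_Arr[OF q(1) s'(3) c] by blast
  note p = pullback_Arr[OF pb q(1) s'(3) c]
  have t: "t \<in> Arr C" "Cod C t = Prod C A A" using p(1,3) q by simp_all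
  have m: "monic C t"
    unfolding monic_def
  proof (intro conjI allI ballI impI)
    fix T u v assume "u \<in> hom C T (Dom C t)" "v \<in> hom C T (Dom C t)" and eq: "t \<cdot> u = t \<cdot> v"
    then have uv: "u \<in> Arr C" "v \<in> Arr C" "Dom C u = Dom C v" "Cod C u = Dom C t" "Cod C v = Dom C t"
      by (auto simp: hom_def)
    have "s \<cdot> (k \<cdot> u) = (s \<cdot> k) \<cdot> u" using p(1-5) uv s' by simp
    also have "\<dots> = square_map C f \<cdot> (t \<cdot> u)" unfolding p(6)[symmetric] using t uv q by simp
    also have "\<dots> = (s \<cdot> k) \<cdot> v" unfolding eq p(6)[symmetric] using t uv q by simp
    also have "\<dots> = s \<cdot> (k \<cdot> v)" using p(1-5) uv s' by simp
    finally have "k \<cdot> u = k \<cdot> v"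
      by (rule monicD[OF s'(2), rotated -1]) (use p(1-5) uv in simp_all)
    then show "u = v" by (rule p(8)[OF uv eq])
  qed (rule t)
  have "points C A t = {(a, b). a \<in> arrows_into C A \<and> b \<in> arrows_into C A \<and> Dom C a = Dom C b \<and>
       (f \<cdot> a, f \<cdot> b) \<in> points C X s}" (is "_ = ?P")
  proof (intro equalityI subrelI)
    fix a b assume "(a, b) \<in> points C A t"
    then obtain h where h: "h \<in> Arr C" "Cod C h = Dom C t" "a = leg1 C A t \<cdot> h" "b = leg2 C A t \<cdot> h"
      by (rule pointsE)
    have "f \<cdot> a = leg1 C X (square_map C f \<cdot> t) \<cdot> h" "f \<cdot> b = leg2 C X (square_map C f \<cdot> t) \<cdot> h"
      unfolding legs_square_map[OF f t] using h t O by simp_all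
    then have "f \<cdot> a = leg1 C X s \<cdot> (k \<cdot> h)" "f \<cdot> b = leg2 C X s \<cdot> (k \<cdot> h)"
      unfolding p(6) using leg_Comp[of X s k] O s' p(1-5) h by simp_all
    then have "(f \<cdot> a, f \<cdot> b) \<in> points C X s" using pointsI[of "k \<cdot> h" s X] p(1-5) h by simp
    then show "(a, b) \<in> ?P" using h t O by (simp add: arrows_into_def)
  next
    fix a b assume "(a, b) \<in> ?P"
    then have ab: "a \<in> Arr C" "b \<in> Arr C" "Dom C a = Dom C b" "Cod C a = A" "Cod C b = A"
      and fab: "(f \<cdot> a, f \<cdot> b) \<in> points C X s" by (auto simp: arrows_into_def)
    obtain h where h: "h \<in> Arr C" "Cod C h = Dom C s" "f \<cdot> a = leg1 C X s \<cdot> h" "f \<cdot> b = leg2 C X s \<cdot> h"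
      using pointsE[OF fab] .
    have d: "Dom C h = Dom C a" using arg_cong[OF h(3), of "Dom C"] ab h(1,2) O s' by simp
    have "square_map C f \<cdot> tuple C a b = s \<cdot> h"
      by (rule leg_ext[OF O(2)])
        (use legs_square_map[OF f, of "tuple C a b"] leg_Comp[of X s h] ab h d O s' in simp_all)
    then obtain l where l: "l \<in> Arr C" "Cod C l = Dom C t" "t \<cdot> l = tuple C a b"
      using p(7)[of "tuple C a b" h] ab h d q by auto
    have "a = leg1 C A t \<cdot> l" "b = leg2 C A t \<cdot> l"
      using leg_Comp[OF O(1) t l(1,2)] l(3) ab by simp_all
    then show "(a, b) \<in> points C A t" using pointsI[of l t A] l by simp
  qed
  then have "t \<in> relation_of C A ?P" using m t by (simp add: relation_of_def)
  then have ne: "relation_of C A ?P \<noteq> {}" by blast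
  show thesis
    using that[OF relation_of_relation[OF O(1) ne, unfolded s'(1)]] unfolding s'(1) by blast
qed

end

section \<open>Alternating products and powers of plain relations\<close>

text \<open>The product of \<open>n + 1\<close> alternating factors, with \<open>P\<close> applied last, to match \<open>alternating\<close> at
  \<open>Suc n\<close>. Note that \<open>O\<close> writes the relation that is applied last on the right.\<close>

fun alternating_relcomp :: "'a rel \<Rightarrow> 'a rel \<Rightarrow> nat \<Rightarrow> 'a rel" where
  "alternating_relcomp P Q 0 = P"
| "alternating_relcomp P Q (Suc n) = alternating_relcomp Q P n O P"

lemma alternating_relcomp_absorb:
  assumes "P O P = P"
  shows "alternating_relcomp P Q n O P = alternating_relcomp P Q n"
  using assms by (cases n) (auto simp only: alternating_relcomp.simps O_assoc)

lemma alternating_relcomp_subset_trans: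
  assumes "P \<subseteq> E" "Q \<subseteq> E" "trans E"
  shows "alternating_relcomp P Q n \<subseteq> E"
  using assms(1,2)
proof (induction n arbitrary: P Q)
  case (Suc n)
  have "alternating_relcomp Q P n O P \<subseteq> E O E" using Suc by (intro relcomp_mono) auto
  then show ?case using assms(3) by (simp add: trans_O_subset order_trans)
qed simp

text \<open>Between two consecutive factors \<open>F\<inverse> O P O F\<close> there is an \<open>F O F\<inverse>\<close>.\<close>

lemma conjugate_power_alternating:
  "F\<inverse> O alternating_relcomp P (F O F\<inverse>) (2 * m) O F = (F\<inverse> O P O F) ^^ Suc m"
proof (induction m)
  case (Suc m)
  have "F\<inverse> O alternating_relcomp P (F O F\<inverse>) (2 * Suc m) O F
      = (F\<inverse> O alternating_relcomp P (F O F\<inverse>) (2 * m) O F) O (F\<inverse> O P O F)"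
    by (simp add: O_assoc)
  then show ?case unfolding Suc by simp
qed simp

text \<open>For a functional \<open>F\<close>, the first and the last \<open>F O F\<inverse>\<close> are absorbed by the conjugating
  \<open>F\<inverse>\<close> and \<open>F\<close>, so that only the \<open>m\<close> factors \<open>P\<close> count.\<close>

lemma conjugate_alternating_subset_power:
  assumes "F\<inverse> O F \<subseteq> Id"
  shows "F\<inverse> O alternating_relcomp (F O F\<inverse>) P (2 * m) O F \<subseteq> (F\<inverse> O P O F) ^^ m"
proof -
  have "F\<inverse> O alternating_relcomp (F O F\<inverse>) P (2 * m) \<subseteq> (F\<inverse> O P O F) ^^ m O F\<inverse>"
  proof (induction m)
    case 0
    have "(F\<inverse> O F) O F\<inverse> \<subseteq> Id O F\<inverse>" by (rule relcomp_mono[OF assms order_refl])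
    then show ?case by (simp add: O_assoc)
  next
    case (Suc m)
    have "F\<inverse> O alternating_relcomp (F O F\<inverse>) P (2 * Suc m)
        = (F\<inverse> O alternating_relcomp (F O F\<inverse>) P (2 * m)) O (P O F O F\<inverse>)" by (simp add: O_assoc)
    also have "\<dots> \<subseteq> ((F\<inverse> O P O F) ^^ m O F\<inverse>) O (P O F O F\<inverse>)"
      by (rule relcomp_mono[OF Suc order_refl])
    also have "\<dots> = (F\<inverse> O P O F) ^^ Suc m O F\<inverse>" by (simp add: O_assoc)
    finally show ?case .
  qed
  then have "(F\<inverse> O alternating_relcomp (F O F\<inverse>) P (2 * m)) O F \<subseteq> ((F\<inverse> O P O F) ^^ m O F\<inverse>) O F"
    by (rule relcomp_mono) simp
  also have "\<dots> \<subseteq> (F\<inverse> O P O F) ^^ m O Id"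
    unfolding O_assoc by (rule relcomp_mono[OF order_refl assms])
  finally show ?thesis by (simp add: O_assoc)
qed

text \<open>Adjacent factors \<open>P O P\<close> merge.\<close>

lemma power_sandwich_alternating:
  assumes "P O P = P"
  shows "(P O Q O P) ^^ Suc k = alternating_relcomp P Q (2 * Suc k)"
proof (induction k)
  case 0 show ?case by (simp add: O_assoc numeral_2_eq_2)
next
  case (Suc k)
  have "(P O Q O P) ^^ Suc (Suc k) = (alternating_relcomp P Q (2 * Suc k) O P) O (Q O P)"
    unfolding relpow.simps(2)[of "Suc k"] Suc by (simp add: O_assoc)
  also have "\<dots> = alternating_relcomp P Q (2 * Suc k) O (Q O P)"
    by (simp only: alternating_relcomp_absorb[OF assms])
  also have "\<dots> = alternating_relcomp P Q (2 * Suc (Suc k))" by (simp add: O_assoc)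
  finally show ?case .
qed

lemma equiv_relcomp_idem:
  assumes "equiv A P"
  shows "P O P = P"
  using assms unfolding equiv_def refl_on_def trans_def by blast

lemma refl_on_subset_relpow:
  assumes "refl_on A P" "P \<subseteq> A \<times> A"
  shows "P \<subseteq> P ^^ Suc k"
proof (induction k)
  case (Suc k)
  show ?case
  proof (rule subrelI)
    fix x y assume "(x, y) \<in> P"
    then have "(x, y) \<in> P ^^ Suc k" "(y, y) \<in> P" using Suc assms by (auto simp: refl_on_def)
    then show "(x, y) \<in> P ^^ Suc (Suc k)" by auto
  qed
qed simp

lemma sym_relpow: "sym P \<Longrightarrow> sym (P ^^ k)"
proof (induction k)
  case (Suc k)
  have "(y, x) \<in> P ^^ Suc k" if xy: "(x, y) \<in> P ^^ Suc k" for x y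
  proof -
    obtain z where "(x, z) \<in> P ^^ k" "(z, y) \<in> P" using xy by auto
    then have "(y, z) \<in> P" "(z, x) \<in> P ^^ k" using Suc by (auto dest: symD)
    then show ?thesis by (rule relpow_Suc_I2)
  qed
  then show ?case unfolding sym_def by blast
qed (simp add: sym_def)

lemma trans_relpow_subset:
  assumes "P \<subseteq> E" "trans E"
  shows "P ^^ Suc k \<subseteq> E"
proof (induction k)
  case (Suc k)
  have "P ^^ Suc k O P \<subseteq> E O E" by (rule relcomp_mono[OF Suc assms(1)])
  then show ?case using assms(2) by (simp add: trans_O_subset order_trans)
qed (use assms in simp)

section \<open>Congruence permutability\<close>

context regular_category begin

lemma stable_alternating_relcomp:
  "stable C P \<Longrightarrow> stable C Q \<Longrightarrow> stable C (alternating_relcomp P Q n)"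
  by (induction n arbitrary: P Q) (simp_all add: stable_relcomp)

lemma stable_relpow: "stable C P \<Longrightarrow> stable C (P ^^ Suc k)"
  by (induction k) (simp_all add: stable_relcomp)

lemma stable_graph:
  assumes "f \<in> Arr C"
  shows "stable C (graph C f)" "stable C ((graph C f)\<inverse>)"
proof -
  show "stable C (graph C f)"
    unfolding stable_def using assms by (auto simp: graph_def arrows_into_def)
  then show "stable C ((graph C f)\<inverse>)" by (rule stable_converse)
qed

lemma alternating_relation:
  assumes "relation_on C X R" "relation_on C X S"
  shows "relation_on C X (alternating C X R S (Suc n)) \<and>
    pairs C X (alternating C X R S (Suc n)) =
      local_closure C (alternating_relcomp (pairs C X R) (pairs C X S) n)"
  using assms
proof (induction n arbitrary: R S)
  case 0 then show ?case by (simp add: pairs_local)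
next
  case (Suc n)
  note IH = Suc.IH[OF Suc.prems(2,1)]
  have "local_closure C (pairs C X (alternating C X S R (Suc n)) O pairs C X R)
      = local_closure C (local_closure C (alternating_relcomp (pairs C X S) (pairs C X R) n)
          O local_closure C (pairs C X R))"
    using IH pairs_local[OF Suc.prems(1)] by simp
  also have "\<dots> = local_closure C (alternating_relcomp (pairs C X R) (pairs C X S) (Suc n))"
    using local_closure_relcomp[of "alternating_relcomp (pairs C X S) (pairs C X R) n" "pairs C X R"]
      stable_alternating_relcomp stable_pairs Suc.prems by simp
  finally show ?case using rel_comp_relation[of X "alternating C X S R (Suc n)" R] IH Suc.prems by simp
qed

text \<open>The exponent is positive because \<open>A ^^ 0\<close> is the identity of the whole type of arrows instead of the
  diagonal of \<open>X\<close>.\<close>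

lemma rel_power_relation:
  assumes D: "relation_on C X D" and A: "stable C A" "pairs C X D = local_closure C A"
  shows "relation_on C X (rel_power C X D (Suc k)) \<and>
    pairs C X (rel_power C X D (Suc k)) = local_closure C (A ^^ Suc k)"
proof (induction k)
  case 0 show ?case using D A by simp
next
  case (Suc k)
  show ?case
    using Suc rel_comp_relation[of X "rel_power C X D (Suc k)" D] D A(2)
      local_closure_relcomp[OF stable_relpow[OF A(1)] A(1)] by simp
qed

lemma congruence_permutable_iff:
  "congruence_permutable C (Suc n) \<longleftrightarrow> (\<forall>X R S. equivalence_on C X R \<and> equivalence_on C X S \<longrightarrow>
     local_closure C (alternating_relcomp (pairs C X R) (pairs C X S) n) =
     local_closure C (alternating_relcomp (pairs C X S) (pairs C X R) n))"
proof -
  have "alternating C X R S (Suc n) = alternating C X S R (Suc n) \<longleftrightarrow>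
     local_closure C (alternating_relcomp (pairs C X R) (pairs C X S) n) =
     local_closure C (alternating_relcomp (pairs C X S) (pairs C X R) n)"
    if "equivalence_on C X R" "equivalence_on C X S" for X R S
    using relation_eq_iff[of X "alternating C X R S (Suc n)" "alternating C X S R (Suc n)"]
      alternating_relation[of X R S n] alternating_relation[of X S R n]
      that[THEN equivalence_relation_on] by simp
  then show ?thesis unfolding congruence_permutable_def by blast
qed

lemma equivalence_equiv:
  "equivalence_on C X R \<Longrightarrow> equiv (arrows_into C X) (pairs C X R)"
  using equivalence_iff equivalence_relation_on by blast

text \<open>The product of \<open>n + 2\<close> factors that ends in \<open>P\<close> arises from a product of \<open>n + 1\<close> factors by one
  more \<open>P\<close>. Permutability makes \<open>P\<close> the outer factor of the latter, which then absorbs the new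
  one. So both alternating products collapse to the shorter ones, which agree.\<close>

lemma congruence_permutable_Suc:
  assumes "congruence_permutable C (Suc n)"
  shows "congruence_permutable C (Suc (Suc n))"
  unfolding congruence_permutable_iff
proof (intro allI impI)
  fix X R S assume RS: "equivalence_on C X R \<and> equivalence_on C X S"
  have collapse: "local_closure C (alternating_relcomp (pairs C X R) (pairs C X S) (Suc n))
      = local_closure C (alternating_relcomp (pairs C X R) (pairs C X S) n)"
    if "equivalence_on C X R" "equivalence_on C X S" for R S
  proof -
    let ?P = "pairs C X R" and ?Q = "pairs C X S"
    have st: "stable C ?P" "stable C ?Q" using that equivalence_relation_on stable_pairs by blast+
    have "local_closure C (alternating_relcomp ?Q ?P n O ?P)
        = local_closure C (local_closure C (alternating_relcomp ?Q ?P n) O local_closure C ?P)"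
      using local_closure_relcomp st stable_alternating_relcomp by simp
    also have "\<dots> = local_closure C (local_closure C (alternating_relcomp ?P ?Q n) O local_closure C ?P)"
      using assms that unfolding congruence_permutable_iff by metis
    also have "\<dots> = local_closure C (alternating_relcomp ?P ?Q n O ?P)"
      using local_closure_relcomp st stable_alternating_relcomp by simp
    also have "\<dots> = local_closure C (alternating_relcomp ?P ?Q n)"
      using alternating_relcomp_absorb equiv_relcomp_idem[OF equivalence_equiv[OF that(1)]] by metis
    finally show ?thesis by simp
  qed
  show "local_closure C (alternating_relcomp (pairs C X R) (pairs C X S) (Suc n))
      = local_closure C (alternating_relcomp (pairs C X S) (pairs C X R) (Suc n))"
    using collapse[of R S] collapse[of S R] RS assms unfolding congruence_permutable_iff by metis
qed

lemma congruence_permutable_mono: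
  assumes "congruence_permutable C k" "1 \<le> k" "k \<le> n"
  shows "congruence_permutable C n"
  using assms(3,1,2)
proof (induction n rule: dec_induct)
  case (step n)
  then obtain n' where "n = Suc n'" by (cases n) auto
  then show ?case using step congruence_permutable_Suc by simp
qed

section \<open>Direct images of equivalence relations\<close>

lemma ex_inverse_equivalence:
  assumes f: "f \<in> hom C A X" and S: "equivalence_on C X S"
  obtains T where "equivalence_on C A T"
    "pairs C A T = {(a, b). a \<in> arrows_into C A \<and> b \<in> arrows_into C A \<and> Dom C a = Dom C b \<and>
       (f \<cdot> a, f \<cdot> b) \<in> pairs C X S}"
proof -
  obtain T where T: "relation_on C A T" and p: "pairs C A T = {(a, b). a \<in> arrows_into C A \<and>
      b \<in> arrows_into C A \<and> Dom C a = Dom C b \<and> (f \<cdot> a, f \<cdot> b) \<in> pairs C X S}"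
    using ex_inverse_relation[OF f equivalence_relation_on[OF S]] .
  have fa: "f \<cdot> a \<in> arrows_into C X" if "a \<in> arrows_into C A" for a
    using that homD[OF f] by (auto simp: arrows_into_def)
  have "equiv (arrows_into C A) (pairs C A T)"
  proof (rule equivI)
    show "refl_on (arrows_into C A) (pairs C A T)"
      using fa equivalence_equiv[OF S] unfolding p equiv_def refl_on_def by blast
    show "sym (pairs C A T)"
      using equivalence_equiv[OF S] unfolding p equiv_def sym_def by auto
    show "trans (pairs C A T)"
      using equivalence_equiv[OF S] unfolding p equiv_def trans_def by auto
  qed (auto simp: p)
  then show thesis using that T p equivalence_iff by blast
qed

lemma diagonal_equivalence:
  assumes "X \<in> Obj C"
  shows "equivalence_on C X (diagonal C X)"
  unfolding equivalence_iff[OF diagonal_relation(1)[OF assms]] diagonal_relation(2)[OF assms]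
  by (auto simp: equiv_def refl_on_def sym_def trans_def)

lemma graph_converse_comp_subset: "(graph C f)\<inverse> O graph C f \<subseteq> Id"
  by (auto simp: graph_def)

lemma ex_kernel_equivalence:
  assumes f: "f \<in> hom C X Y"
  obtains K where "equivalence_on C X K" "pairs C X K = graph C f O (graph C f)\<inverse>"
proof -
  have Y: "Y \<in> Obj C" and f': "f \<in> Arr C" "Dom C f = X" "Cod C f = Y" using homD[OF f] by auto
  obtain K where K: "equivalence_on C X K" and p: "pairs C X K = {(a, b). a \<in> arrows_into C X \<and>
      b \<in> arrows_into C X \<and> Dom C a = Dom C b \<and> (f \<cdot> a, f \<cdot> b) \<in> pairs C Y (diagonal C Y)}"
    using ex_inverse_equivalence[OF f diagonal_equivalence[OF Y]] .
  have "Dom C a = Dom C b" if "a \<in> arrows_into C X" "b \<in> arrows_into C X" "f \<cdot> a = f \<cdot> b" for a b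
    using arg_cong[OF that(3), of "Dom C"] that(1,2) f' by (simp add: arrows_into_def)
  moreover have "f \<cdot> a \<in> arrows_into C Y" if "a \<in> arrows_into C X" for a
    using that f' by (simp add: arrows_into_def)
  ultimately have "pairs C X K = graph C f O (graph C f)\<inverse>"
    unfolding p diagonal_relation(2)[OF Y] graph_def f'(2) by (auto simp: Id_on_def)
  then show thesis using that K by blast
qed

text \<open>If the powers of \<open>A\<close> locally stop growing at one exponent, they do so at all larger exponents, in
  particular at the double one, which is the composite of the power with itself.\<close>

lemma trans_local_closure_power:
  assumes A: "stable C A" and step: "A ^^ Suc (Suc k) \<subseteq> local_closure C (A ^^ Suc k)"
  shows "trans (local_closure C (A ^^ Suc k))"
proof -
  note st = stable_relpow[OF A, of k]
  have le: "A ^^ (Suc k + j) \<subseteq> local_closure C (A ^^ Suc k)" for j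
  proof (induction j)
    case 0 show ?case using local_closure_increasing[OF st] by simp
  next
    case (Suc j)
    have "A ^^ (Suc k + Suc j) = A ^^ (Suc k + j) O A" by simp
    also have "\<dots> \<subseteq> local_closure C (A ^^ Suc k) O local_closure C A"
      by (rule relcomp_mono[OF Suc local_closure_increasing[OF A]])
    also have "\<dots> \<subseteq> local_closure C (A ^^ Suc (Suc k))"
      using local_closure_relcomp_subset[OF st A] by simp
    also have "\<dots> \<subseteq> local_closure C (A ^^ Suc k)" by (rule local_closure_least[OF step])
    finally show ?case .
  qed
  have "local_closure C (A ^^ Suc k) O local_closure C (A ^^ Suc k) \<subseteq> local_closure C (A ^^ (Suc k + Suc k))"
    using local_closure_relcomp_subset[OF st st] by (simp only: relpow_add)
  also have "\<dots> \<subseteq> local_closure C (A ^^ Suc k)" by (rule local_closure_least[OF le])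
  finally show ?thesis by (auto simp: trans_def)
qed

text \<open>Reflexivity holds only locally: an element \<open>y\<close> of the codomain lifts to some \<open>x\<close> along the cover
  obtained by pulling back the regular epimorphism \<open>f\<close>.\<close>

lemma conjugate_equivalence_refl_sym:
  assumes f: "f \<in> hom C X Y" "regular_epi C f" and R: "equivalence_on C X R"
  defines "A \<equiv> (graph C f)\<inverse> O pairs C X R O graph C f"
  shows "stable C A" "sym A" "refl_on (arrows_into C Y) (local_closure C A)"
proof -
  have f': "f \<in> Arr C" "Dom C f = X" "Cod C f = Y" using homD[OF f(1)] by auto
  note eq = equivalence_equiv[OF R]
  show st: "stable C A"
    unfolding A_def
    using stable_graph[OF f'(1)] stable_pairs[OF equivalence_relation_on[OF R]] by (intro stable_relcomp)
  have "sym (pairs C X R)" using eq by (simp add: equiv_def)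
  then show "sym A" unfolding A_def sym_def by blast
  show "refl_on (arrows_into C Y) (local_closure C A)"
    unfolding refl_on_def
  proof
    fix y assume "y \<in> arrows_into C Y"
    then have y: "y \<in> Arr C" "Cod C y = Cod C f" using f' by (auto simp: arrows_into_def)
    obtain e x where e: "regular_epi C e" "e \<in> Arr C" "Cod C e = Dom C y" "x \<in> Arr C"
      "Cod C x = Dom C f" "Dom C x = Dom C e" "y \<cdot> e = f \<cdot> x" using cover_pullback[OF f(2) y] .
    have "x \<in> arrows_into C X" using e f' by (simp add: arrows_into_def)
    then have "(x, x) \<in> pairs C X R" "(x, y \<cdot> e) \<in> graph C f"
      using eq e(7) f' by (auto simp: equiv_def refl_on_def graph_def)
    then have "(y \<cdot> e, y \<cdot> e) \<in> A" unfolding A_def by blast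
    then show "(y, y) \<in> local_closure C A" using y e by (intro local_closureI) auto
  qed
qed

text \<open>Permutability is applied to \<open>R\<close> and the kernel equivalence of \<open>f\<close>. It shortens the power
  \<open>m + 1\<close> of \<open>F\<inverse> O P O F\<close> to the power \<open>m\<close>.\<close>

lemma direct_image_power_equivalence:
  assumes perm: "congruence_permutable C (2 * m + 1)" and m: "m \<ge> 1"
    and f: "f \<in> hom C X Y" "regular_epi C f" and R: "equivalence_on C X R"
  shows "equivalence_on C Y (rel_power C Y (direct_image C f R) m)"
proof -
  obtain k where k: "m = Suc k" using m by (cases m) auto
  let ?F = "graph C f" and ?P = "pairs C X R"
  define A where "A = ?F\<inverse> O ?P O ?F"
  have f': "f \<in> Arr C" using homD[OF f(1)] by simp
  note A = conjugate_equivalence_refl_sym[OF f R, folded A_def]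
  note D = direct_image_relation[OF f(1) equivalence_relation_on[OF R], folded A_def]
  have pow: "relation_on C Y (rel_power C Y (direct_image C f R) m)"
    "pairs C Y (rel_power C Y (direct_image C f R) m) = local_closure C (A ^^ m)"
    using rel_power_relation[OF D(1) A(1) D(2), of k] k by simp_all
  obtain K where K: "equivalence_on C X K" "pairs C X K = ?F O ?F\<inverse>"
    using ex_kernel_equivalence[OF f(1)] .
  let ?K = "?F O ?F\<inverse>"
  have st: "stable C ?P" "stable C ?K" "stable C ?F" "stable C (?F\<inverse>)"
    using stable_pairs[OF equivalence_relation_on[OF R]] stable_pairs[OF equivalence_relation_on[OF K(1)]]
      K(2) stable_graph[OF f'] by simp_all
  have alt: "alternating_relcomp ?P ?K (2 * m) \<subseteq> local_closure C (alternating_relcomp ?K ?P (2 * m))"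
    using local_closure_increasing[OF stable_alternating_relcomp[OF st(1,2)], of "2 * m"] perm R K
    unfolding Suc_eq_plus1[symmetric] congruence_permutable_iff by metis
  have "A ^^ Suc m = ?F\<inverse> O alternating_relcomp ?P ?K (2 * m) O ?F"
    unfolding A_def conjugate_power_alternating ..
  also have "\<dots> \<subseteq> local_closure C (?F\<inverse>) O local_closure C (alternating_relcomp ?K ?P (2 * m))
      O local_closure C ?F"
    by (intro relcomp_mono alt local_closure_increasing st)
  also have "\<dots> \<subseteq> local_closure C (?F\<inverse>) O local_closure C (alternating_relcomp ?K ?P (2 * m) O ?F)"
    by (intro relcomp_mono order_refl local_closure_relcomp_subset stable_alternating_relcomp st)
  also have "\<dots> \<subseteq> local_closure C (?F\<inverse> O alternating_relcomp ?K ?P (2 * m) O ?F)"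
    by (intro local_closure_relcomp_subset stable_relcomp stable_alternating_relcomp st)
  also have "\<dots> \<subseteq> local_closure C (A ^^ m)"
    unfolding A_def
    by (rule local_closure_mono[OF conjugate_alternating_subset_power[OF graph_converse_comp_subset]])
  finally have step: "A ^^ Suc m \<subseteq> local_closure C (A ^^ m)" .
  have "equiv (arrows_into C Y) (local_closure C (A ^^ m))"
  proof (rule equivI)
    show "local_closure C (A ^^ m) \<subseteq> arrows_into C Y \<times> arrows_into C Y"
      using pairs_arrows_into[OF pow(1)] pow(2) by simp
    show "trans (local_closure C (A ^^ m))"
      using trans_local_closure_power[OF A(1), of k] step k by simp
    have "sym (A ^^ m)" by (rule sym_relpow[OF A(2)])
    then show "sym (local_closure C (A ^^ m))"
      by (simp add: sym_conv_converse_eq local_closure_converse)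
    \<comment> \<open>\<open>A\<close> itself is only locally reflexive, so reflexivity is raised to the power through its closure.\<close>
    have "local_closure C A \<subseteq> local_closure C A ^^ Suc k"
      using refl_on_subset_relpow[OF A(3)] pairs_arrows_into[OF D(1)] D(2) by simp
    also have "\<dots> \<subseteq> local_closure C (local_closure C A ^^ Suc k)"
      by (rule local_closure_increasing[OF stable_relpow[OF stable_local_closure[OF A(1)]]])
    also have "\<dots> = local_closure C (A ^^ m)"
      using rel_power_relation[OF D(1) stable_local_closure[OF A(1)], of k] D(2) pairs_local[OF D(1)]
        pow k by simp
    finally show "refl_on (arrows_into C Y) (local_closure C (A ^^ m))"
      using A(3) unfolding refl_on_def by blast
  qed
  then show ?thesis using equivalence_iff[OF pow(1)] pow(2) by simp
qed

text \<open>The hypothesis is applied to the second leg of \<open>R\<close> and the inverse image of \<open>S\<close> along the first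
  leg, whose direct image is \<open>R S R\<close>.\<close>

lemma permutable_if_direct_image_power_equivalence:
  assumes m: "m \<ge> 1"
    and img: "\<And>X Y f R. f \<in> hom C X Y \<Longrightarrow> regular_epi C f \<Longrightarrow> equivalence_on C X R \<Longrightarrow>
      equivalence_on C Y (rel_power C Y (direct_image C f R) m)"
  shows "congruence_permutable C (2 * m + 1)"
proof -
  obtain k where k: "m = Suc k" using m by (cases m) auto
  have le: "local_closure C (alternating_relcomp (pairs C X S) (pairs C X R) (2 * m))
      \<subseteq> local_closure C (alternating_relcomp (pairs C X R) (pairs C X S) (2 * m))"
    if R: "equivalence_on C X R" and S: "equivalence_on C X S" for X R S
  proof -
    let ?P = "pairs C X R" and ?Q = "pairs C X S"
    note relR = equivalence_relation_on[OF R] and relS = equivalence_relation_on[OF S]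
    note eqP = equivalence_equiv[OF R] and eqQ = equivalence_equiv[OF S]
    note X = relation_onD(1)[OF relR]
    obtain r where r: "r \<in> R" using relation_onD(3)[OF relR] by blast
    note r' = relation_onD(4,6,7)[OF relR r]
    let ?f = "leg2 C X r"
    have f: "?f \<in> hom C (Dom C r) X" "leg1 C X r \<in> hom C (Dom C r) X"
      using X r' by (simp_all add: hom_def)
    \<comment> \<open>Reflexivity of \<open>R\<close>, applied to the identity of \<open>X\<close>, provides a section of the second leg.\<close>
    have "(Ident C X, Ident C X) \<in> points C X r"
      using r'(1) eqP X by (auto simp: equiv_def refl_on_def arrows_into_def)
    then obtain s where s: "s \<in> Arr C" "Cod C s = Dom C r" "Ident C X = ?f \<cdot> s" by (rule pointsE)
    have "Dom C s = X" using arg_cong[OF s(3), of "Dom C"] s(1,2) X r' by simp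
    then have epi: "regular_epi C ?f"
      by (intro split_epi_regular[of _ s]) (use s(1,2) s(3)[symmetric] X r' in simp_all)
    obtain T where T: "equivalence_on C (Dom C r) T"
      "pairs C (Dom C r) T = {(a, b). a \<in> arrows_into C (Dom C r) \<and> b \<in> arrows_into C (Dom C r) \<and>
         Dom C a = Dom C b \<and> (leg1 C X r \<cdot> a, leg1 C X r \<cdot> b) \<in> ?Q}"
      using ex_inverse_equivalence[OF f(2) S] .
    define A where "A = (graph C ?f)\<inverse> O pairs C (Dom C r) T O graph C ?f"
    have "A = (points C X r)\<inverse> O ?Q O points C X r"
    proof -
      have "Dom C a = Dom C b" if ab: "a \<in> arrows_into C (Dom C r)" "b \<in> arrows_into C (Dom C r)"
        "(leg1 C X r \<cdot> a, leg1 C X r \<cdot> b) \<in> ?Q" for a b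
        using stableD(3)[OF stable_pairs[OF relS] ab(3)] ab(1,2) X r' by (simp add: arrows_into_def)
      moreover have "Dom C ?f = Dom C r" using X r' by simp
      ultimately show ?thesis unfolding A_def T(2) graph_def points_def by auto
    qed
    also have "\<dots> = ?P O ?Q O ?P"
      using r'(1) eqP by (simp add: equiv_def sym_conv_converse_eq)
    finally have A: "A = ?P O ?Q O ?P" .
    note stA = conjugate_equivalence_refl_sym(1)[OF f(1) epi T(1), folded A_def]
    note D = direct_image_relation[OF f(1) equivalence_relation_on[OF T(1)], folded A_def]
    have pow: "A ^^ m = alternating_relcomp ?P ?Q (2 * m)"
      unfolding A k by (rule power_sandwich_alternating[OF equiv_relcomp_idem[OF eqP]])
    let ?E = "local_closure C (A ^^ m)"
    have E: "equiv (arrows_into C X) ?E"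
      using equivalence_equiv[OF img[OF f(1) epi T(1)]]
        rel_power_relation[OF D(1) stA D(2), of k] k by simp
    have "?P \<subseteq> A" "?Q \<subseteq> A" and A': "refl_on (arrows_into C X) A" "A \<subseteq> arrows_into C X \<times> arrows_into C X"
      unfolding A using eqP eqQ unfolding equiv_def refl_on_def by blast+
    moreover have "A \<subseteq> ?E"
      using refl_on_subset_relpow[OF A', of k] local_closure_increasing[OF stable_relpow[OF stA, of k]] k
      by simp
    ultimately have "alternating_relcomp ?Q ?P (2 * m) \<subseteq> ?E"
      using E by (intro alternating_relcomp_subset_trans) (auto simp: equiv_def)
    then show ?thesis unfolding pow by (rule local_closure_least)
  qed
  show ?thesis
    unfolding Suc_eq_plus1[symmetric] congruence_permutable_iff using le by blast
qed

section \<open>Cocartesian images\<close>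

lemma Equ_arrow_iff:
  assumes f: "f \<in> hom C X Y" and R: "relation_on C X R" and S: "relation_on C Y S"
  shows "sub_le C R (inverse_image C f S) \<longleftrightarrow>
    (graph C f)\<inverse> O pairs C X R O graph C f \<subseteq> pairs C Y S"
proof -
  have Y: "Y \<in> Obj C" using homD[OF f] by simp
  have "(\<exists>h \<in> hom C (Dom C r) (Dom C s). s \<cdot> h = square_map C f \<cdot> r) \<longleftrightarrow>
      (graph C f)\<inverse> O pairs C X R O graph C f \<subseteq> pairs C Y S" if r: "r \<in> R" and s: "s \<in> S" for r s
  proof -
    note r' = relation_onD(4,6,7)[OF R r] and s' = relation_onD(4,6,7)[OF S s]
    note l = legs_square_map[OF f r'(2,3)]
    show ?thesis
      using points_subset_iff_factor[OF Y l(1,3) s'(2,3)] points_square_map[OF f r'(2,3)] r'(1) s'(1) l(2)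
      by simp
  qed
  then show ?thesis
    using sub_le_inverse_image[OF f R S] relation_onD(3)[OF R] relation_onD(3)[OF S] by blast
qed

text \<open>An equivalence relation contains \<open>f(R)\<close> as soon as \<open>f\<close> maps \<open>R\<close> into it, and by transitivity it then
  contains all positive powers of \<open>f(R)\<close>. So the power that is assumed to be an equivalence relation is the
  universal target.\<close>

lemma cocartesian_direct_image:
  assumes f: "f \<in> hom C X Y" "regular_epi C f" and R: "equivalence_on C X R" and m: "m \<ge> 1"
    and eq: "equivalence_on C Y (rel_power C Y (direct_image C f R) m)"
  shows "\<exists>\<phi> \<in> Arr (Equ C). Dom (Equ C) \<phi> = (X, R) \<and> on_arr ground \<phi> = f \<and>
    cocartesian (Equ C) C ground \<phi>"
proof -
  obtain k where k: "m = Suc k" using m by (cases m) auto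
  have Y: "Y \<in> Obj C" and f': "Cod C f = Y" "f \<in> Arr C" using homD[OF f(1)] by auto
  define Q where "Q = rel_power C Y (direct_image C f R) m"
  note Q = eq[folded Q_def]
  note relR = equivalence_relation_on[OF R] and relQ = equivalence_relation_on[OF Q]
  define A where "A = (graph C f)\<inverse> O pairs C X R O graph C f"
  note A = conjugate_equivalence_refl_sym[OF f R, folded A_def]
  note D = direct_image_relation[OF f(1) relR, folded A_def]
  have pow: "pairs C Y Q = local_closure C (local_closure C A ^^ Suc k)"
    using rel_power_relation[OF D(1) stable_local_closure[OF A(1)], of k] D(2) pairs_local[OF D(1)] k
    unfolding Q_def by simp
  have "A \<subseteq> local_closure C A" by (rule local_closure_increasing[OF A(1)])
  also have "\<dots> \<subseteq> local_closure C A ^^ Suc k"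
    using refl_on_subset_relpow[OF A(3)] pairs_arrows_into[OF D(1)] D(2) by simp
  also have "\<dots> \<subseteq> pairs C Y Q"
    unfolding pow by (rule local_closure_increasing[OF stable_relpow[OF stable_local_closure[OF A(1)]]])
  finally have "sub_le C R (inverse_image C f Q)"
    using Equ_arrow_iff[OF f(1) relR relQ] by (simp add: A_def)
  then have \<phi>: "((X, R), f, (Y, Q)) \<in> Arr (Equ C)"
    using R Q f by (simp add: Equ_def)
  have least: "sub_le C Q (inverse_image C (Ident C Y) S)"
    if S: "equivalence_on C Y S" and le: "sub_le C R (inverse_image C f S)" for S
  proof -
    note relS = equivalence_relation_on[OF S]
    have "local_closure C A \<subseteq> pairs C Y S"
      using le Equ_arrow_iff[OF f(1) relR relS] local_closure_mono[of A "pairs C Y S" C] pairs_local[OF relS]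
      unfolding A_def by simp
    then have "local_closure C A ^^ Suc k \<subseteq> pairs C Y S"
      using equivalence_equiv[OF S] by (intro trans_relpow_subset) (simp_all add: equiv_def)
    then have "pairs C Y Q \<subseteq> pairs C Y S"
      unfolding pow using local_closure_mono[of _ "pairs C Y S" C] pairs_local[OF relS] by blast
    moreover have "graph C (Ident C Y) \<subseteq> Id"
      using Y by (auto simp: graph_def arrows_into_def)
    ultimately have "(graph C (Ident C Y))\<inverse> O pairs C Y Q O graph C (Ident C Y) \<subseteq> pairs C Y S"
      by blast
    then show ?thesis using Equ_arrow_iff[OF Ident_hom[OF Y] relQ relS] by simp
  qed
  have "cocartesian (Equ C) C ground ((X, R), f, (Y, Q))"
    unfolding cocartesian_def
  proof (intro conjI allI ballI impI)
    fix W \<phi>' assume h: "\<phi>' \<in> hom (Equ C) (Dom (Equ C) ((X, R), f, (Y, Q))) W"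
      "on_arr ground \<phi>' = on_arr ground ((X, R), f, (Y, Q))"
    obtain Z S where W: "W = (Z, S)" by (cases W)
    have "\<phi>' \<in> hom (Equ C) (X, R) (Z, S)" using h(1) W by (simp add: Equ_def)
    then have \<phi>': "\<phi>' = ((X, R), f, (Z, S))" "equivalence_on C Z S" "f \<in> hom C X Z"
      "sub_le C R (inverse_image C f S)"
      using h(2) unfolding Equ_hom by (auto simp: ground_def)
    have Z: "Z = Y" using \<phi>'(3) f' by (simp add: hom_def)
    have \<psi>: "((Y, Q), Ident C Y, (Y, S)) \<in> hom (Equ C) (Y, Q) (Y, S)"
      unfolding Equ_hom using least \<phi>'(2,4) Z Q Ident_hom[OF Y] by simp
    show "\<exists>!\<psi>. \<psi> \<in> hom (Equ C) (Cod (Equ C) ((X, R), f, (Y, Q))) W \<and>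
        Comp (Equ C) \<psi> ((X, R), f, (Y, Q)) = \<phi>' \<and>
        on_arr ground \<psi> = Ident C (on_obj ground (Cod (Equ C) ((X, R), f, (Y, Q))))"
    proof (rule ex1I[of _ "((Y, Q), Ident C Y, (Y, S))"])
      show "((Y, Q), Ident C Y, (Y, S)) \<in> hom (Equ C) (Cod (Equ C) ((X, R), f, (Y, Q))) W \<and>
        Comp (Equ C) ((Y, Q), Ident C Y, (Y, S)) ((X, R), f, (Y, Q)) = \<phi>' \<and>
        on_arr ground ((Y, Q), Ident C Y, (Y, S))
          = Ident C (on_obj ground (Cod (Equ C) ((X, R), f, (Y, Q))))"
      proof (intro conjI)
        show "((Y, Q), Ident C Y, (Y, S)) \<in> hom (Equ C) (Cod (Equ C) ((X, R), f, (Y, Q))) W"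
          using \<psi> W Z by (simp add: Equ_def)
        show "Comp (Equ C) ((Y, Q), Ident C Y, (Y, S)) ((X, R), f, (Y, Q)) = \<phi>'"
          using \<phi>'(1) Z Ident_Comp[OF f(1)] by (simp add: Equ_def)
      qed (simp add: Equ_def ground_def)
      fix \<psi> assume \<psi>': "\<psi> \<in> hom (Equ C) (Cod (Equ C) ((X, R), f, (Y, Q))) W \<and>
        Comp (Equ C) \<psi> ((X, R), f, (Y, Q)) = \<phi>' \<and>
        on_arr ground \<psi> = Ident C (on_obj ground (Cod (Equ C) ((X, R), f, (Y, Q))))"
      then have "\<psi> \<in> hom (Equ C) (Y, Q) (Y, S)" using W Z by (simp add: Equ_def)
      then obtain g where "\<psi> = ((Y, Q), g, (Y, S))" unfolding Equ_hom by blast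
      then show "\<psi> = ((Y, Q), Ident C Y, (Y, S))" using \<psi>' by (simp add: Equ_def ground_def)
    qed
  qed (rule \<phi>)
  then show ?thesis using \<phi> by (intro bexI[of _ "((X, R), f, (Y, Q))"]) (simp_all add: Equ_def ground_def)
qed

end

theorem theorem6p3:
  fixes E :: "('o, 'a) cat" and m :: nat
  assumes "regular_category E" and "m \<ge> 1"
  shows
    "(congruence_permutable E (2 * m + 1) \<longleftrightarrow>
       (\<forall>X Y f R. f \<in> hom E X Y \<and> regular_epi E f \<and> equivalence_on E X R \<longrightarrow>
          equivalence_on E Y (rel_power E Y (direct_image E f R) m)))
     \<and> (congruence_permutable E (2 * m) \<longrightarrow>
       (\<forall>X Y f R. f \<in> hom E X Y \<and> regular_epi E f \<and> equivalence_on E X R \<longrightarrow>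
          equivalence_on E Y (rel_power E Y (direct_image E f R) m)))
     \<and> (\<forall>n\<ge>2. congruence_permutable E n \<longrightarrow>
       (\<forall>X Y f R. f \<in> hom E X Y \<and> regular_epi E f \<and> equivalence_on E X R \<longrightarrow>
          (\<exists>\<phi> \<in> Arr (Equ E). Dom (Equ E) \<phi> = (X, R) \<and> on_arr ground \<phi> = f \<and>
               cocartesian (Equ E) E ground \<phi>)))"
proof -
  interpret regular_category E by (rule assms(1))
  have odd: "equivalence_on E Y (rel_power E Y (direct_image E f R) k)"
    if "congruence_permutable E (2 * k + 1)" "k \<ge> 1" "f \<in> hom E X Y" "regular_epi E f" "equivalence_on E X R"
    for k X Y f R
    using direct_image_power_equivalence that by blast
  have coc: "\<exists>\<phi> \<in> Arr (Equ E). Dom (Equ E) \<phi> = (X, R) \<and> on_arr ground \<phi> = f \<and>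
      cocartesian (Equ E) E ground \<phi>"
    if n: "n \<ge> 2" "congruence_permutable E n" and f: "f \<in> hom E X Y" "regular_epi E f" "equivalence_on E X R"
    for n X Y f R
  proof -
    have "congruence_permutable E (2 * n + 1)"
      by (rule congruence_permutable_mono[OF n(2)]) (use n in simp_all)
    then show ?thesis using cocartesian_direct_image[OF f, of n] odd[OF _ _ f] n by simp
  qed
  have even: "congruence_permutable E (2 * m + 1)" if "congruence_permutable E (2 * m)"
    by (rule congruence_permutable_mono[OF that]) (use assms(2) in simp_all)
  show ?thesis
    using odd[OF _ assms(2)] even permutable_if_direct_image_power_equivalence[OF assms(2)] coc by blast
qed

end
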